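(* Let $G$ be a Métivier group with structure matrices $U^{(1)},\dots,U^{(m)}$ and let $\lambda\in\mathbb R^m\setminus\{0\}$. Suppose $K\subset\mathbb C^n$ $(n\ge2)$ is a non-harmonic complex cone such that $K_\lambda$ is aligned with one of the coordinate axes in $\mathbb C^n$. Let $f$ be a continuous function on $\mathbb C^n$ such that $f\times_\lambda\mu_r(z)=0$ for all $r>0$ and $z\in K$. Then $f=0$.
   Context: **Métivier group and twisted spherical mean.** $U^{(1)},\dots,U^{(m)}$ are real skew-symmetric $2n\times2n$ matrices such that $V_\lambda=\sum_{j}\lambda_jU^{(j)}$ is non-singular for every $\lambda\in\mathbb R^m\setminus\{0\}$; the Métivier group is $\mathbb R^{2n}\times\mathbb R^m$ with law $(x,t)(\xi,\tau)=(x+\xi,(t_j+\tau_j+\frac12\langle x,U^{(j)}\xi\rangle)_j)$. Identify $x=(x_1,\dots,x_n,y_1,\dots,y_n)\in\mathbb R^{2n}$ with its complexification $z=(x_1+iy_1,\dots,x_n+iy_n)\in\mathbb C^n$; $U^{(j)}w$ denotes the complexification of $U^{(j)}\xi$ if $w$ is that of $\xi$, and $z\cdot w=\sum_jz_jw_j$. With $\mu_s$ the normalized surface measure on $\{|w|=s\}\subset\mathbb C^n$, $$f\times_\lambda\mu_s(z)=\int_{|w|=s}f(z-w)\,e^{\frac i2\sum_{j=1}^m\lambda_j\mathrm{Re}(z\cdot\overline{U^{(j)}w})}\,d\mu_s(w).$$ **The matrix $A_\lambda$.** Let $\pm i\mu_{\lambda,1},\dots,\pm i\mu_{\lambda,n}$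 with $\mu_{\lambda,1}\ge\cdots\ge\mu_{\lambda,n}>0$ be the eigenvalues of $V_\lambda$ with corresponding eigenvectors $u_j\pm iv_j$, chosen so that $A_\lambda=(\sqrt2v_1,\dots,\sqrt2v_n,\sqrt2u_1,\dots,\sqrt2u_n)$ is orthogonal; then $V_\lambda A_\lambda=A_\lambda U_\lambda$ with $U_\lambda=\begin{pmatrix} 0 & -J_\lambda \\ J_\lambda & 0 \end{pmatrix}$, $J_\lambda=\mathrm{diag}(\mu_{\lambda,1},\dots,\mu_{\lambda,n})$. If $z$ is the complexification of $x$, $\tilde z_\lambda$ denotes the complexification of $A_\lambda x$. **Cones.** A complex cone is a set $K\subset\mathbb C^n$ $(n\geq 2)$ closed under complex scaling. It is non-harmonic if it is not contained in the zero set of any nonzero bi-graded homogeneous harmonic polynomial, i.e. of any nonzero harmonic polynomial of the form $\sum_{|\alpha|=p,|\beta|=q}c_{\alpha\beta}z^\alpha\bar z^\beta$, $p,q\in\mathbb Z_+$. For a complex cone $K$, $K_\lambda=\{z\in\mathbb C^n:\tilde z_\lambda\in K\}$. "$K_\lambda$ is aligned with one of the coordinate axes" means that $K_\lambda$ contains a complex coordinate axis, i.e. for some $j$ all points $(0,\dots,0,z_j,0,\dots,0)$, $z_j\in\mathbb C$, lie in $K_\lambda$. *)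

theory Defs
  imports "HOL-Analysis.Analysis" "HOL-Algebra.Group"
begin

(* The index type 'n + 'n numbers the real coordinates (x_1,...,x_n,y_1,...,y_n) of R^(2n):
   Inl j is the position of x_j and Inr j that of y_j. *)

definition complexify :: "real ^ ('n::finite + 'n) \<Rightarrow> complex ^ 'n"
  where "complexify x = (\<chi> j. Complex (x $ Inl j) (x $ Inr j))"

definition realify :: "complex ^ 'n \<Rightarrow> real ^ ('n::finite + 'n)"
  where "realify z = (\<chi> a. case a of Inl j \<Rightarrow> Re (z $ j) | Inr j \<Rightarrow> Im (z $ j))"

lemma complexify_realify: "complexify (realify z) = z"
  by (simp add: complexify_def realify_def vec_eq_iff)

lemma realify_complexify: "realify (complexify x) = x"
  by (simp add: complexify_def realify_def vec_eq_iff split: sum.split)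


section \<open>Metivier groups\<close>

definition V_mat ::
    "('m::finite \<Rightarrow> real ^ ('n::finite + 'n) ^ ('n + 'n)) \<Rightarrow> real ^ 'm \<Rightarrow> real ^ ('n + 'n) ^ ('n + 'n)"
  where "V_mat U l = (\<Sum>j\<in>UNIV. (l $ j) *\<^sub>R U j)"

definition metivier_mult ::
    "('m::finite \<Rightarrow> real ^ ('n::finite + 'n) ^ ('n + 'n))
      \<Rightarrow> (real ^ ('n + 'n)) \<times> (real ^ 'm) \<Rightarrow> (real ^ ('n + 'n)) \<times> (real ^ 'm)
      \<Rightarrow> (real ^ ('n + 'n)) \<times> (real ^ 'm)"
  where "metivier_mult U p q =
    (fst p + fst q, \<chi> j. snd p $ j + snd q $ j + (1/2) * (fst p \<bullet> (U j *v fst q)))"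

definition metivier_group ::
    "((real ^ ('n::finite + 'n)) \<times> (real ^ 'm::finite)) monoid
      \<Rightarrow> ('m \<Rightarrow> real ^ ('n + 'n) ^ ('n + 'n)) \<Rightarrow> bool"
  where "metivier_group G U \<longleftrightarrow>
    (\<forall>j. transpose (U j) = - U j) \<and>
    (\<forall>l. l \<noteq> 0 \<longrightarrow> invertible (V_mat U l)) \<and>
    G = \<lparr>carrier = UNIV, mult = metivier_mult U, one = (0, 0)\<rparr>"


section \<open>Twisted spherical means\<close>

(* Normalized surface measure on the sphere of radius s > 0 in polar coordinates:
   the measure of a Borel subset s E of the sphere, with E in the unit sphere, is
   vol {t w | 0 < t <= 1, w in E} / vol (unit ball). *)
definition sphere_measure :: "real \<Rightarrow> 'a::euclidean_space measure"
  where "sphere_measure s =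
    distr (uniform_measure lborel (cball 0 1)) borel (\<lambda>w. (s / norm w) *\<^sub>R w)"

definition twisted_spherical_mean ::
    "('m::finite \<Rightarrow> real ^ ('n::finite + 'n) ^ ('n + 'n)) \<Rightarrow> real ^ 'm
      \<Rightarrow> (complex ^ 'n \<Rightarrow> complex) \<Rightarrow> real \<Rightarrow> complex ^ 'n \<Rightarrow> complex"
  where "twisted_spherical_mean U l f s z =
    (\<integral>w. f (z - w) *
        exp (\<i> / 2 * complex_of_real
          (\<Sum>j\<in>UNIV. l $ j * Re (\<Sum>k\<in>UNIV. z $ k * cnj (complexify (U j *v realify w) $ k))))
      \<partial>sphere_measure s)"


section \<open>The matrix \<open>A\<^sub>\<lambda>\<close>\<close>

definition A_mat ::
    "('n \<Rightarrow> real ^ ('n::finite + 'n)) \<Rightarrow> ('n \<Rightarrow> real ^ ('n + 'n)) \<Rightarrow> real ^ ('n + 'n) ^ ('n + 'n)"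
  where "A_mat u v = (\<chi> a b. case b of Inl j \<Rightarrow> sqrt 2 * v j $ a | Inr j \<Rightarrow> sqrt 2 * u j $ a)"

definition complex_mat :: "real ^ 'k ^ 'l \<Rightarrow> complex ^ 'k ^ 'l"
  where "complex_mat M = (\<chi> a b. complex_of_real (M $ a $ b))"

definition complex_vec :: "real ^ 'k \<Rightarrow> real ^ 'k \<Rightarrow> complex ^ 'k"
  where "complex_vec u v = (\<chi> a. complex_of_real (u $ a) + \<i> * complex_of_real (v $ a))"

(* The eigenvalues \<plusminus>i mu_j of V, listed in decreasing order, with eigenvectors u_j \<plusminus> i v_j.
   Orthogonality of A_mat makes these 2n vectors a basis of C^(2n), so that they are nonzero
   and the \<plusminus>i mu_j are all the eigenvalues, with multiplicity. *)
definition spectral_data ::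
    "real ^ ('n::{finite,linorder} + 'n) ^ ('n + 'n)
      \<Rightarrow> ('n \<Rightarrow> real) \<Rightarrow> ('n \<Rightarrow> real ^ ('n + 'n)) \<Rightarrow> ('n \<Rightarrow> real ^ ('n + 'n)) \<Rightarrow> bool"
  where "spectral_data V mu u v \<longleftrightarrow>
    (\<forall>j k. j \<le> k \<longrightarrow> mu k \<le> mu j) \<and>
    (\<forall>j. 0 < mu j) \<and>
    (\<forall>j. complex_mat V *v complex_vec (u j) (v j)
           = (\<i> * complex_of_real (mu j)) *s complex_vec (u j) (v j)) \<and>
    (\<forall>j. complex_mat V *v complex_vec (u j) (- v j)
           = (- \<i> * complex_of_real (mu j)) *s complex_vec (u j) (- v j)) \<and>
    orthogonal_matrix (A_mat u v)"

definition tilde :: "real ^ ('n::finite + 'n) ^ ('n + 'n) \<Rightarrow> complex ^ 'n \<Rightarrow> complex ^ 'n"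
  where "tilde A z = complexify (A *v realify z)"


section \<open>Cones\<close>

definition is_complex_cone :: "(complex ^ 'n) set \<Rightarrow> bool"
  where "is_complex_cone K \<longleftrightarrow> (\<forall>c. \<forall>z\<in>K. c *s z \<in> K)"

definition bigraded_poly ::
    "nat \<Rightarrow> nat \<Rightarrow> (('n::finite \<Rightarrow> nat) \<Rightarrow> ('n \<Rightarrow> nat) \<Rightarrow> complex) \<Rightarrow> complex ^ 'n \<Rightarrow> complex"
  where "bigraded_poly p q c z =
    (\<Sum>\<alpha> | sum \<alpha> UNIV = p. \<Sum>\<beta> | sum \<beta> UNIV = q.
      c \<alpha> \<beta> * (\<Prod>j\<in>UNIV. (z $ j) ^ \<alpha> j) * (\<Prod>j\<in>UNIV. cnj (z $ j) ^ \<beta> j))"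

definition dir_deriv :: "('a::real_vector \<Rightarrow> 'b::real_normed_vector) \<Rightarrow> 'a \<Rightarrow> 'a \<Rightarrow> 'b"
  where "dir_deriv f b x = vector_derivative (\<lambda>t. f (x + t *\<^sub>R b)) (at 0)"

definition laplacian :: "('a::euclidean_space \<Rightarrow> 'b::real_normed_vector) \<Rightarrow> 'a \<Rightarrow> 'b"
  where "laplacian f x = (\<Sum>b\<in>Basis. dir_deriv (\<lambda>y. dir_deriv f b y) b x)"

(* No smoothness is demanded: only polynomials are considered below. *)
definition harmonic_fun :: "('a::euclidean_space \<Rightarrow> 'b::real_normed_vector) \<Rightarrow> bool"
  where "harmonic_fun f \<longleftrightarrow> (\<forall>x. laplacian f x = 0)"

definition non_harmonic :: "(complex ^ 'n::finite) set \<Rightarrow> bool"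
  where "non_harmonic K \<longleftrightarrow>
    \<not> (\<exists>p q c. bigraded_poly p q c \<noteq> (\<lambda>_. 0) \<and> harmonic_fun (bigraded_poly p q c) \<and>
        K \<subseteq> {z. bigraded_poly p q c z = 0})"

definition cone_pullback ::
    "real ^ ('n::finite + 'n) ^ ('n + 'n) \<Rightarrow> (complex ^ 'n) set \<Rightarrow> (complex ^ 'n) set"
  where "cone_pullback A K = {z. tilde A z \<in> K}"

definition aligned_with_axis :: "(complex ^ 'n::finite) set \<Rightarrow> bool"
  where "aligned_with_axis S \<longleftrightarrow> (\<exists>j. \<forall>c. axis j c \<in> S)"

end

theory Submission
  imports Defs
begin

text \<open>
  Write \<open>\<langle>x, y\<rangle>\<close> for the real inner product of \<open>\<complex>\<^sup>n\<close> and \<open>\<omega>(x, w)\<close> for the bilinear form in the phase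
  of the twisted mean. For \<open>x \<in> K\<close> all means of \<open>f(y) exp(- i \<omega>(x, y) / 2)\<close> over spheres centred at \<open>x\<close>
  vanish, so this function is orthogonal to every continuous function of the distance \<open>\<bar>x - y\<bar>\<close> with compact support.
  The functions used here are truncated powers, for which the squared distance to \<open>t k\<close>, with \<open>k \<in> K\<close> and \<open>t\<close> real,
  can be corrected by the constant \<open>t\<^sup>2 \<bar>k\<bar>\<^sup>2\<close>. The correction leaves
  \<open>\<integral> f(y) exp(- i t \<omega>(k, y) / 2) \<rho>(S - \<bar>y\<bar>\<^sup>2 + 2 t \<langle>k, y\<rangle>) dy = 0\<close>, and the derivative of order \<open>N\<close> at \<open>t = 0\<close>
  is a relation between the moments of degree \<open>N\<close>:
  \<open>\<Sum>\<^sub>b (N choose b) \<integral> f(y) (- i \<omega>(k, y) / 2)\<^bsup>N-b\<^esup> (2 \<langle>k, y\<rangle>)\<^bsup>b\<^esup> \<rho>\<^bsup>(b)\<^esup>(S - \<bar>y\<bar>\<^sup>2) dy = 0\<close>.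

  By induction on \<open>N\<close>, every moment of degree \<open>N\<close> of \<open>f\<close> against a truncated power of \<open>S - \<bar>y\<bar>\<^sup>2\<close> is zero
  (\<open>ramp_moments_zero\<close>). Once the moments of lower degree vanish, the polynomial
  \<open>x \<mapsto> \<integral> f(y) \<langle>x, y\<rangle>\<^sup>N \<rho>(S - \<bar>y\<bar>\<^sup>2) dy\<close> is harmonic: its Laplacian is a moment of degree \<open>N - 2\<close>, the factor
  \<open>\<bar>y\<bar>\<^sup>2\<close> being absorbed by the radial weight. Since \<open>K\<close> is a complex cone, a polynomial that vanishes on \<open>K\<close>
  has bigraded components that vanish on \<open>K\<close>; so, \<open>K\<close> being non-harmonic, the moments of degree \<open>N\<close> are
  determined by their values at \<open>k \<in> K\<close> (\<open>moment_zero_if_zero_on_cone\<close>), and, the space being of finite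
  dimension, by the values at finitely many such \<open>k\<close> (\<open>finite_interpolation\<close>). The twist contributes only to
  the terms \<open>b < N\<close>. As functions of \<open>S\<close>, these are, by the interpolation, combinations of repeated primitives of
  untwisted terms \<open>b = N\<close>. The relation is therefore a homogeneous linear differential system for finitely many functions of \<open>S\<close> that
  vanish at \<open>S = 0\<close>, and its only solution is zero (\<open>linear_system_zero\<close>).

  A continuous function on a box all of whose moments vanish is zero, by the Stone-Weierstrass theorem
  (\<open>zero_if_moments_zero\<close>).
\<close>

section \<open>From spherical means to integrals\<close>

lemma integral_cball_scale:
  fixes F :: "'a::euclidean_space \<Rightarrow> complex"
  assumes "r > 0" "F \<in> borel_measurable borel"
  shows "(\<integral>w. indicator (cball 0 r) w *\<^sub>R F w \<partial>lborel)
    = of_real (r ^ DIM('a)) * (\<integral>w. indicator (cball 0 1) w *\<^sub>R F (r *\<^sub>R w) \<partial>lborel)"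
proof -
  have [measurable]: "cball (0::'a) r \<in> sets borel" "F \<in> borel_measurable borel" using assms by auto
  have m: "(\<lambda>w. indicator (cball 0 r) w *\<^sub>R F w) \<in> borel_measurable borel"
    by measurable
  have ind: "indicator (cball 0 r) (r *\<^sub>R w) = (indicator (cball 0 1) w :: real)" for w :: 'a
    using assms(1) by (auto simp: indicator_def)
  have "(\<integral>w. indicator (cball 0 r) w *\<^sub>R F w \<partial>lborel)
      = (\<integral>w. indicator (cball 0 r) w *\<^sub>R F w \<partial>density (distr lborel borel (\<lambda>x. 0 + r *\<^sub>R x)) (\<lambda>_. \<bar>r\<bar>^DIM('a)))"
    using assms(1) by (subst lborel_affine[of r 0]) auto
  also have "\<dots> = (\<integral>w. (r^DIM('a)) *\<^sub>R (indicator (cball 0 r) w *\<^sub>R F w) \<partial>(distr lborel borel (\<lambda>x. 0 + r *\<^sub>R x)))"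
    using assms(1) m by (subst integral_density) (auto simp: abs_of_pos)
  also have "\<dots> = (\<integral>w. (r^DIM('a)) *\<^sub>R (indicator (cball 0 r) (r *\<^sub>R w) *\<^sub>R F (r *\<^sub>R w)) \<partial>lborel)"
    using assms(2) by (subst integral_distr) auto
  also have "\<dots> = (r^DIM('a)) *\<^sub>R (\<integral>w. indicator (cball 0 1) w *\<^sub>R F (r *\<^sub>R w) \<partial>lborel)"
    by (simp only: ind integral_scaleR_right)
  finally show ?thesis by (simp add: scaleR_conv_of_real)
qed

text \<open>
  The image measure that defines the spherical mean turns it into the mean over the unit ball of the
  function that is constant on rays.
\<close>
lemma sphere_mean_eq_ball_integral:
  fixes F :: "'a::euclidean_space \<Rightarrow> complex"
  assumes "F \<in> borel_measurable borel"
  shows "(\<integral>w. F w \<partial>sphere_measure s) = 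
    (\<integral>w. indicator (cball 0 1) w *\<^sub>R F ((s / norm w) *\<^sub>R w) \<partial>lborel) / of_real (measure lborel (cball (0::'a) 1))"
proof -
  let ?v = "measure lborel (cball (0::'a) 1)"
  have v: "emeasure lborel (cball (0::'a) 1) = ennreal ?v" "?v > 0"
    using emeasure_lborel_cball_finite[of "0::'a" 1]
    by (auto intro!: emeasure_eq_ennreal_measure)
  have d: "(\<lambda>x. indicator (cball (0::'a) 1) x / emeasure lborel (cball (0::'a) 1))
    = (\<lambda>x. ennreal (indicator (cball 0 1) x / ?v))"
    using v by (auto simp: fun_eq_iff indicator_def divide_ennreal simp flip: ennreal_1)
  have "(\<integral>w. F w \<partial>sphere_measure s) = (\<integral>w. F ((s / norm w) *\<^sub>R w) \<partial>(uniform_measure lborel (cball 0 1)))"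
    unfolding sphere_measure_def using assms by (subst integral_distr) auto
  also have "\<dots> = (\<integral>w. (indicator (cball (0::'a) 1) w / ?v) *\<^sub>R F ((s / norm w) *\<^sub>R w) \<partial>lborel)"
    unfolding uniform_measure_def d using assms v(2) by (subst integral_density) (auto intro!: borel_measurable_divide borel_measurable_indicator)
  also have "\<dots> = (\<integral>w. (1/?v) *\<^sub>R (indicator (cball (0::'a) 1) w *\<^sub>R F ((s / norm w) *\<^sub>R w)) \<partial>lborel)"
    by (intro arg_cong[where f="integral\<^sup>L lborel"] ext) (simp add: field_simps)
  also have "\<dots> = (1/?v) *\<^sub>R (\<integral>w. indicator (cball (0::'a) 1) w *\<^sub>R F ((s / norm w) *\<^sub>R w) \<partial>lborel)"
    by (rule integral_scaleR_right)
  finally show ?thesis by (simp add: scaleR_conv_of_real)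
qed

text \<open>
  On a thin shell \<open>r < \<bar>w\<bar> \<le> s\<close> the function \<open>H\<close> is uniformly close to its radial extension from the sphere of
  radius \<open>s\<close>. The integral of that extension over the shell is a multiple of the spherical mean, hence zero. So
  the integral over a shell is at most \<open>\<epsilon>\<close> times its volume, and the shells of a partition of \<open>[0, R]\<close> add up
  to \<open>\<epsilon>\<close> times the volume of a ball.
\<close>
lemma integral_eq_0_if_sphere_means_0:
  fixes H :: "'a::euclidean_space \<Rightarrow> complex"
  assumes cont: "continuous_on UNIV H"
    and means: "\<And>s. s > 0 \<Longrightarrow> (\<integral>w. H w \<partial>sphere_measure s) = 0"
    and supp: "\<And>w. norm w > R \<Longrightarrow> H w = 0" and "R > 0"
  shows "(\<integral>w. H w \<partial>lborel) = 0"
proof -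
  have [measurable]: "cball (0::'a) r \<in> sets borel" for r by simp
  have Hm[measurable]: "H \<in> borel_measurable borel"
    using cont by (rule borel_measurable_continuous_onI)
  (* The radial extension of H from the sphere of radius s; at the origin, where division by zero is zero,
    its value is H 0 and does not affect integrals. *)
  define th where "th s w = H ((s / norm w) *\<^sub>R w)" for s w
  define vol where "vol r = measure lborel (cball (0::'a) r)" for r
  have th_m[measurable]: "th s \<in> borel_measurable borel" for s
    unfolding th_def by measurable
  have bnd: "\<exists>B. \<forall>w. norm (H w) \<le> B"
  proof -
    have "compact (H ` cball 0 R)"
      by (intro compact_continuous_image continuous_on_subset[OF cont]) auto
    then obtain B where B: "\<And>x. x \<in> H ` cball 0 R \<Longrightarrow> norm x \<le> B"
      by (meson bounded_iff compact_imp_bounded)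
    have "norm (H w) \<le> max B 0" for w
      using B[of "H w"] supp[of w] by (cases "norm w \<le> R") auto
    then show ?thesis by blast
  qed
  then obtain B where B: "\<And>w. norm (H w) \<le> B" by blast
  have int: "integrable lborel (\<lambda>w. indicator (cball 0 r) w *\<^sub>R F w)"
    if [measurable]: "F \<in> borel_measurable borel" and "\<And>w. norm (F w) \<le> B" for r and F :: "'a \<Rightarrow> complex"
  proof (rule Bochner_Integration.integrable_bound)
    show "integrable lborel (\<lambda>w. B * indicator (cball (0::'a) r) w)"
      using emeasure_lborel_cball_finite[of "0::'a" r] by simp
    show "AE w in lborel. norm (indicator (cball 0 r) w *\<^sub>R F w) \<le> norm (B * indicator (cball 0 r) w)"
      using that(2) by (auto simp: indicator_def intro!: AE_I2 order_trans[OF _ abs_ge_self])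
  qed measurable
  have thB: "norm (th s w) \<le> B" for s w by (simp add: th_def B)
  have th0: "(\<integral>w. indicator (cball 0 r) w *\<^sub>R th s w \<partial>lborel) = 0" if "r \<ge> 0" "s > 0" for r s
  proof (cases "r = 0")
    case True
    have "AE w in lborel. indicator (cball 0 r) w *\<^sub>R th s w = 0"
      using AE_lborel_singleton[of "0::'a"] by eventually_elim (auto simp: True indicator_def)
    then show ?thesis by (rule integral_eq_zero_AE)
  next
    case False
    with that have r: "r > 0" by simp
    have "th s (r *\<^sub>R w) = th s w" for w
      using r by (cases "w = 0") (auto simp: th_def)
    then have "(\<integral>w. indicator (cball 0 r) w *\<^sub>R th s w \<partial>lborel)
      = of_real (r ^ DIM('a)) * (\<integral>w. indicator (cball 0 1) w *\<^sub>R th s w \<partial>lborel)"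
      by (subst integral_cball_scale[OF r]) auto
    moreover have "(\<integral>w. indicator (cball 0 1) w *\<^sub>R th s w \<partial>lborel) = 0"
      using means[OF that(2)] sphere_mean_eq_ball_integral[OF Hm, of s]
        content_cball_pos[of 1 "0::'a"]
      by (simp add: th_def)
    ultimately show ?thesis by simp
  qed
  define A where "A r = (\<integral>w. indicator (cball 0 r) w *\<^sub>R H w \<partial>lborel)" for r
  have uc: "uniformly_continuous_on (cball 0 R) H"
    by (intro compact_uniformly_continuous continuous_on_subset[OF cont]) auto
  (* The radial extension is taken from the outer radius s, which is positive even if r = 0. *)
  have step: "norm (A s - A r) \<le> e * (vol s - vol r)"
    if rs: "0 \<le> r" "r < s" "s \<le> R" and e: "e > 0" and
      d: "\<And>x y. x \<in> cball 0 R \<Longrightarrow> y \<in> cball 0 R \<Longrightarrow> dist x y < dl \<Longrightarrow> dist (H x) (H y) < e"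
      and dl: "s - r < dl" for r s e dl
  proof -
    have eq: "A s - A r = (\<integral>w. (indicator (cball 0 s) w *\<^sub>R H w - indicator (cball 0 r) w *\<^sub>R H w)
       - (indicator (cball 0 s) w *\<^sub>R th s w - indicator (cball 0 r) w *\<^sub>R th s w) \<partial>lborel)"
      using rs th0[of r s] th0[of s s] int[of H] int[of "th s"] B thB unfolding A_def
      by (simp add: Bochner_Integration.integral_diff)
    have "norm (A s - A r) \<le> (\<integral>w. e * indicator (cball (0::'a) s) w - e * indicator (cball 0 r) w \<partial>lborel)"
      unfolding eq
    proof (rule Bochner_Integration.integral_norm_bound_integral)
      fix w :: 'a
      have "norm (H w - th s w) \<le> e" if w: "r < norm w" "norm w \<le> s"
      proof -
        have "w - (s / norm w) *\<^sub>R w = (1 - s / norm w) *\<^sub>R w" by (simp add: scaleR_diff_left)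
        then have "norm (w - (s / norm w) *\<^sub>R w) = \<bar>1 - s / norm w\<bar> * norm w" by simp
        also have "\<dots> = \<bar>(1 - s / norm w) * norm w\<bar>" by (simp add: abs_mult)
        also have "(1 - s / norm w) * norm w = norm w - s"
          using w rs by (auto simp: field_simps)
        finally have "dist w ((s / norm w) *\<^sub>R w) < dl" using w dl by (simp add: dist_norm)
        then have "dist (H w) (H ((s / norm w) *\<^sub>R w)) < e" 
          using w rs by (intro d) auto
        then show ?thesis by (simp add: th_def dist_norm)
      qed
      then show "norm (indicator (cball 0 s) w *\<^sub>R H w - indicator (cball 0 r) w *\<^sub>R H w
       - (indicator (cball 0 s) w *\<^sub>R th s w - indicator (cball 0 r) w *\<^sub>R th s w)) \<le>
       e * indicator (cball (0::'a) s) w - e * indicator (cball 0 r) w"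
        using rs e by (auto simp: indicator_def)
    qed (use int[of H] int[of "th s"] B thB emeasure_lborel_cball_finite[of "0::'a"] in auto)
    also have "\<dots> = e * (vol s - vol r)"
      using emeasure_lborel_cball_finite[of "0::'a"]
      by (subst Bochner_Integration.integral_diff) (auto simp: vol_def algebra_simps)
    finally show ?thesis .
  qed
  have small: "norm (A R) \<le> e * vol R" if e: "e > 0" for e
  proof -
    from uc e obtain dl where dl: "dl > 0"
      "\<And>x y. x \<in> cball 0 R \<Longrightarrow> y \<in> cball 0 R \<Longrightarrow> dist x y < dl \<Longrightarrow> dist (H x) (H y) < e"
      unfolding uniformly_continuous_on_def by metis
    obtain n :: nat where n: "R / dl < real n" using reals_Archimedean2 by blast
    with \<open>R > 0\<close> dl have n0: "n > 0" by (cases n) (auto simp: divide_less_0_iff)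
    have Rn: "R / n < dl" using n n0 dl by (simp add: field_simps)
    define p where "p i = real i * R / n" for i
    have "norm (A (p i) - A (p 0)) \<le> e * (vol (p i) - vol (p 0))" if "i \<le> n" for i
      using that
    proof (induction i)
      case (Suc i)
      have "real (Suc i) * R \<le> real n * R"
        using Suc.prems \<open>R > 0\<close> by (intro mult_right_mono) linarith+
      then have "p (Suc i) \<le> R" using n0 by (simp add: p_def pos_divide_le_eq mult.commute)
      moreover have "p (Suc i) - p i = R / n" by (simp add: p_def algebra_simps add_divide_distrib)
      moreover have "R / n > 0" using n0 \<open>R > 0\<close> by simp
      ultimately have "norm (A (p (Suc i)) - A (p i)) \<le> e * (vol (p (Suc i)) - vol (p i))"
        using \<open>R > 0\<close> Rn by (intro step[OF _ _ _ e dl(2)]) (auto simp: p_def)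
      with Suc show ?case
        using norm_triangle_ineq[of "A (p (Suc i)) - A (p i)" "A (p i) - A (p 0)"]
        by (simp add: algebra_simps)
    qed simp
    from this[of n] n0 have "norm (A R - A 0) \<le> e * (vol R - vol 0)" by (simp add: p_def)
    moreover have "A 0 = 0"
    proof -
      have "AE w in lborel. indicator (cball 0 0) w *\<^sub>R H w = 0"
        using AE_lborel_singleton[of "0::'a"] by eventually_elim (auto simp: indicator_def)
      then show ?thesis unfolding A_def by (rule integral_eq_zero_AE)
    qed
    moreover have "vol 0 = 0" by (simp add: vol_def)
    ultimately show ?thesis by simp
  qed
  have "A R = 0"
  proof (rule ccontr)
    assume "A R \<noteq> 0"
    then have p: "norm (A R) > 0" by simp
    have v: "vol R > 0" using \<open>R > 0\<close> by (simp add: vol_def)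
    from small[of "norm (A R) / (2 * vol R)"] p v show False by (simp add: field_simps)
  qed
  moreover have "A R = (\<integral>w. H w \<partial>lborel)"
    unfolding A_def by (intro arg_cong[where f="integral\<^sup>L lborel"] ext)
      (use supp in \<open>auto simp: indicator_def not_le\<close>)
  ultimately show ?thesis by simp
qed

section \<open>Interpolation and linear differential systems in finite dimension\<close>

text \<open>
  The energy \<open>\<Sum>\<^sub>i \<bar>z\<^sub>i\<bar>\<^sup>2\<close> satisfies \<open>E' \<le> L E\<close>, so \<open>E(s) exp(- L s)\<close> does not increase. The right-hand side of the
  system enters only through a bound, which spares its users from writing down a matrix.
\<close>
lemma linear_system_zero:
  fixes z z' :: "'i \<Rightarrow> real \<Rightarrow> complex"
  assumes I: "finite I" and "0 \<le> T"
    and der: "\<And>i s. i \<in> I \<Longrightarrow> 0 \<le> s \<Longrightarrow> s \<le> T \<Longrightarrow> (z i has_vector_derivative z' i s) (at s)"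
    and bound: "\<And>i s. i \<in> I \<Longrightarrow> 0 \<le> s \<Longrightarrow> s \<le> T \<Longrightarrow> norm (z' i s) \<le> C * (\<Sum>j\<in>I. norm (z j s))"
    and init: "\<And>i. i \<in> I \<Longrightarrow> z i 0 = 0"
    and i: "i \<in> I"
  shows "z i T = 0"
proof -
  define E where "E s = (\<Sum>i\<in>I. z i s \<bullet> z i s)" for s
  define E' where "E' s = (\<Sum>i\<in>I. 2 * (z i s \<bullet> z' i s))" for s
  define L where "L = 2 * \<bar>C\<bar> * card I"
  have dE: "(E has_real_derivative E' s) (at s)" if "0 \<le> s" "s \<le> T" for s
  proof -
    have "((\<lambda>s. z i s \<bullet> z i s) has_real_derivative 2 * (z i s \<bullet> z' i s)) (at s)" if "i \<in> I" for i
    proof -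
      have "((\<lambda>s. z i s \<bullet> z i s) has_derivative (\<lambda>h. z i s \<bullet> (h *\<^sub>R z' i s) + (h *\<^sub>R z' i s) \<bullet> z i s)) (at s)"
        using der[OF \<open>i \<in> I\<close> \<open>0 \<le> s\<close> \<open>s \<le> T\<close>] unfolding has_vector_derivative_def
        by (intro has_derivative_inner)
      then show ?thesis
        unfolding has_field_derivative_def
        by (rule has_derivative_eq_rhs) (auto simp: fun_eq_iff inner_commute algebra_simps)
    qed
    then show ?thesis
      unfolding E_def E'_def by (intro DERIV_sum)
  qed
  have bE: "E' s \<le> L * E s" if "0 \<le> s" "s \<le> T" for s
  proof -
    let ?S = "\<Sum>j\<in>I. norm (z j s)"
    have S: "?S \<ge> 0" by (intro sum_nonneg) auto
    have "E' s \<le> (\<Sum>i\<in>I. 2 * (norm (z i s) * (\<bar>C\<bar> * ?S)))"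
      unfolding E'_def
    proof (intro sum_mono mult_left_mono)
      fix i assume i: "i \<in> I"
      have "z i s \<bullet> z' i s \<le> norm (z i s) * norm (z' i s)" by (rule norm_cauchy_schwarz)
      also have "norm (z' i s) \<le> \<bar>C\<bar> * ?S"
        by (rule order_trans[OF bound[OF i that]]) (intro mult_right_mono S, simp)
      finally show "z i s \<bullet> z' i s \<le> norm (z i s) * (\<bar>C\<bar> * ?S)" by (simp add: mult_left_mono)
    qed simp
    also have "\<dots> = 2 * \<bar>C\<bar> * ?S\<^sup>2"
      by (simp add: power2_eq_square sum_distrib_left sum_distrib_right algebra_simps)
    also have "?S\<^sup>2 \<le> card I * (\<Sum>j\<in>I. (norm (z j s))\<^sup>2)"
      using sum_squared_le_sum_of_squares[of "\<lambda>j. norm (z j s)" I] by (simp add: mult.commute)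
    also have "(\<Sum>j\<in>I. (norm (z j s))\<^sup>2) = E s"
      by (simp add: E_def dot_square_norm)
    finally show ?thesis by (simp add: L_def mult_left_mono mult.assoc)
  qed
  have "E T * exp (- L * T) \<le> E 0 * exp (- L * 0)"
  proof (rule DERIV_nonpos_imp_nonincreasing[OF \<open>0 \<le> T\<close>])
    fix s assume s: "0 \<le> s" "s \<le> T"
    have "((\<lambda>s. E s * exp (- L * s)) has_real_derivative (E' s - L * E s) * exp (- L * s)) (at s)"
      by (rule derivative_eq_intros dE s refl)+ (simp add: algebra_simps)
    moreover have "(E' s - L * E s) * exp (- L * s) \<le> 0"
      using bE[OF s] by (simp add: mult_nonpos_nonneg)
    ultimately show "\<exists>y. ((\<lambda>s. E s * exp (- L * s)) has_real_derivative y) (at s) \<and> y \<le> 0" by blast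
  qed
  moreover have "E 0 = 0" by (simp add: E_def init)
  ultimately have "E T \<le> 0" by (simp add: mult_le_0_iff)
  then have "E T = 0" unfolding E_def by (intro antisym sum_nonneg) auto
  then show ?thesis using i I unfolding E_def by (subst (asm) sum_nonneg_eq_0_iff) auto
qed

text \<open>
  If the functions of a finite-dimensional space \<open>H\<close> are determined by their values on \<open>K\<close>, then finitely many
  points of \<open>K\<close> suffice, and all values are recovered linearly from those at these points. Each point \<open>k\<close> at
  which some member \<open>h0\<close> of \<open>H\<close> does not vanish lowers the dimension by one: the induction passes to the subspace
  of functions vanishing at \<open>k\<close>, and \<open>h0\<close> corrects the result for all of \<open>H\<close>.
\<close>
lemma finite_interpolation:
  fixes H :: "('x \<Rightarrow> complex) set" and b :: "'i \<Rightarrow> 'x \<Rightarrow> complex"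
  assumes "finite I" and "K \<subseteq> X"
    and "\<And>h h' c. h \<in> H \<Longrightarrow> h' \<in> H \<Longrightarrow> (\<lambda>x. h x - c * h' x) \<in> H"
    and "\<And>h. h \<in> H \<Longrightarrow> \<exists>c. \<forall>x\<in>X. h x = (\<Sum>i\<in>I. c i * b i x)"
    and "\<And>h. h \<in> H \<Longrightarrow> \<forall>k\<in>K. h k = 0 \<Longrightarrow> \<forall>x\<in>X. h x = 0"
  shows "\<exists>K0 w. finite K0 \<and> K0 \<subseteq> K \<and> (\<forall>h\<in>H. \<forall>x\<in>X. h x = (\<Sum>k\<in>K0. w x k * h k))"
  using assms(1,3-)
proof (induction I arbitrary: H b rule: finite_psubset_induct)
  case (psubset I)
  note sub = psubset.prems(1) and span = psubset.prems(2) and det = psubset.prems(3)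
  show ?case
  proof (cases "\<forall>h\<in>H. \<forall>x\<in>X. h x = 0")
    case True
    then show ?thesis by (intro exI[of _ "{}"]) auto
  next
    case False
    then obtain h0 k where h0: "h0 \<in> H" "k \<in> K" "h0 k \<noteq> 0" using det by metis
    then have kX: "k \<in> X" using \<open>K \<subseteq> X\<close> by blast
    obtain c0 where "h0 k = (\<Sum>i\<in>I. c0 i * b i k)" using span[OF h0(1)] kX by blast
    with h0(3) obtain j where j: "j \<in> I" "b j k \<noteq> 0"
      by (metis (no_types, lifting) mult_zero_right sum.neutral)
    define H' where "H' = {h\<in>H. h k = 0}"
    (* The value at k eliminates b j from the expansion of functions vanishing at k. *)
    define b' where "b' i x = b i x - b i k / b j k * b j x" for i x
    have span': "\<exists>c. \<forall>x\<in>X. h x = (\<Sum>i\<in>I - {j}. c i * b' i x)" if "h \<in> H'" for h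
    proof -
      from that obtain c where c: "\<And>x. x \<in> X \<Longrightarrow> h x = (\<Sum>i\<in>I. c i * b i x)"
        using span[of h] by (auto simp: H'_def)
      have split: "h x = c j * b j x + (\<Sum>i\<in>I - {j}. c i * b i x)" if "x \<in> X" for x
        using c[OF that] psubset.hyps(1) j by (simp add: sum.remove)
      from split[OF kX] that have "c j = - (\<Sum>i\<in>I - {j}. c i * b i k) / b j k"
        using j by (simp add: H'_def field_simps add_eq_0_iff2)
      then have "h x = (\<Sum>i\<in>I - {j}. c i * b' i x)" if "x \<in> X" for x
        using split[OF that]
        by (simp add: b'_def right_diff_distrib sum_subtractf sum_distrib_right sum_divide_distrib mult.assoc)
      then show ?thesis by blast
    qed
    have "\<exists>K0 w. finite K0 \<and> K0 \<subseteq> K \<and> (\<forall>h\<in>H'. \<forall>x\<in>X. h x = (\<Sum>k\<in>K0. w x k * h k))"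
    proof (rule psubset.IH[of "I - {j}" H' b'])
      show "I - {j} \<subset> I" using j by blast
    qed (use sub span' det in \<open>auto simp: H'_def\<close>)
    then obtain K1 w where K1: "finite K1" "K1 \<subseteq> K"
      and w: "\<And>h x. h \<in> H' \<Longrightarrow> x \<in> X \<Longrightarrow> h x = (\<Sum>k\<in>K1. w x k * h k)" by blast
    define w' where "w' x l = (if l \<in> K1 then w x l else 0)
      + (if l = k then (h0 x - (\<Sum>l\<in>K1. w x l * h0 l)) / h0 k else 0)" for x l
    have "h x = (\<Sum>l\<in>insert k K1. w' x l * h l)" if "h \<in> H" "x \<in> X" for h x
    proof -
      let ?q = "h k / h0 k"
      have "(\<lambda>x. h x - ?q * h0 x) \<in> H'"
        unfolding H'_def mem_Collect_eq using h0(3) by (intro conjI sub[OF that(1) h0(1)]) simp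
      from w[OF this that(2)] have "h x = ?q * h0 x + (\<Sum>l\<in>K1. w x l * (h l - ?q * h0 l))"
        by (simp add: algebra_simps)
      also have "\<dots> = (\<Sum>l\<in>K1. w x l * h l) + (h0 x - (\<Sum>l\<in>K1. w x l * h0 l)) / h0 k * h k"
      proof -
        have "(\<Sum>l\<in>K1. w x l * (h l - ?q * h0 l)) = (\<Sum>l\<in>K1. w x l * h l) - ?q * (\<Sum>l\<in>K1. w x l * h0 l)"
          by (simp add: right_diff_distrib sum_subtractf sum_distrib_left mult_ac)
        moreover have "p / r * a + (s - p / r * t) = s + (a - t) / r * p" for p r a s t :: complex
          by (simp add: diff_divide_distrib algebra_simps)
        ultimately show ?thesis by simp
      qed
      also have "(\<Sum>l\<in>K1. w x l * h l) = (\<Sum>l\<in>insert k K1. (if l \<in> K1 then w x l else 0) * h l)"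
        using K1(1) by (intro sum.mono_neutral_cong_left) auto
      also have "(h0 x - (\<Sum>l\<in>K1. w x l * h0 l)) / h0 k * h k
         = (\<Sum>l\<in>insert k K1. (if l = k then (h0 x - (\<Sum>l\<in>K1. w x l * h0 l)) / h0 k else 0) * h l)"
        using K1(1) by (simp add: if_distrib[of "\<lambda>u. u * _"] sum.delta cong: if_cong)
      finally show ?thesis by (simp add: w'_def distrib_right sum.distrib)
    qed
    with K1 h0(2) show ?thesis
      by (intro exI[of _ "insert k K1"] exI[of _ w']) auto
  qed
qed


section \<open>Moments of a function on a box\<close>

lemma polynomial_vanishing_on_infinite:
  fixes d :: "nat \<Rightarrow> complex"
  assumes "infinite S" "\<And>z. z \<in> S \<Longrightarrow> (\<Sum>m\<le>n. d m * z ^ m) = 0" "m \<le> n"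
  shows "d m = 0"
proof (rule ccontr)
  assume "d m \<noteq> 0"
  then have "finite {z. (\<Sum>m\<le>n. d m * z ^ m) = 0}"
    using assms(3) by (intro polyfun_rootbound_finite) auto
  with assms(1,2) show False by (metis (mono_tags, lifting) finite_subset mem_Collect_eq subsetI)
qed

text \<open>
  For \<open>x + t x'\<close> in place of \<open>x\<close> the integral is a polynomial in \<open>t\<close> that vanishes for all real \<open>t\<close>. The claim is
  the vanishing of its linear coefficient.
\<close>
lemma polarization_step:
  fixes r :: "'a::euclidean_space \<Rightarrow> complex"
  assumes r: "continuous_on (cbox lo hi) r"
    and zero: "\<And>x. integral (cbox lo hi) (\<lambda>y. r y * of_real (x \<bullet> y) ^ Suc n) = 0"
  shows "integral (cbox lo hi) (\<lambda>y. r y * of_real (x' \<bullet> y) * of_real (x \<bullet> y) ^ n) = 0"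
proof -
  define d where "d m = integral (cbox lo hi)
    (\<lambda>y. of_nat (Suc n choose m) * (r y * of_real (x' \<bullet> y) ^ m * of_real (x \<bullet> y) ^ (Suc n - m)))" for m
  note [continuous_intros] = r
  have "(\<Sum>m\<le>Suc n. d m * of_real t ^ m) = 0" for t :: real
  proof -
    have "0 = integral (cbox lo hi) (\<lambda>y. r y * of_real ((t *\<^sub>R x' + x) \<bullet> y) ^ Suc n)" by (simp only: zero)
    also have "(\<lambda>y. r y * of_real ((t *\<^sub>R x' + x) \<bullet> y) ^ Suc n) =
      (\<lambda>y. \<Sum>m\<le>Suc n. of_nat (Suc n choose m) *
        (r y * of_real (x' \<bullet> y) ^ m * of_real (x \<bullet> y) ^ (Suc n - m)) * of_real t ^ m)"
    proof
      fix y
      have "of_real ((t *\<^sub>R x' + x) \<bullet> y) = (of_real t * of_real (x' \<bullet> y) + of_real (x \<bullet> y) :: complex)"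
        by (simp add: inner_simps)
      then show "r y * of_real ((t *\<^sub>R x' + x) \<bullet> y) ^ Suc n = (\<Sum>m\<le>Suc n. of_nat (Suc n choose m) *
        (r y * of_real (x' \<bullet> y) ^ m * of_real (x \<bullet> y) ^ (Suc n - m)) * of_real t ^ m)"
        by (simp only: binomial_ring sum_distrib_left) (simp add: power_mult_distrib mult_ac)
    qed
    also have "integral (cbox lo hi) \<dots> = (\<Sum>m\<le>Suc n. d m * of_real t ^ m)"
      unfolding d_def Henstock_Kurzweil_Integration.integral_mult_left[symmetric]
      by (rule integral_sum) (auto intro!: integrable_continuous continuous_intros)
    finally show ?thesis by simp
  qed
  moreover have "infinite (range complex_of_real)"
    using infinite_UNIV_char_0[where 'a=real] by (simp add: finite_image_iff inj_on_def)
  ultimately have "d 1 = 0"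
    by (intro polynomial_vanishing_on_infinite[where n="Suc n" and d=d and S="range complex_of_real"]) auto
  then show ?thesis by (simp add: d_def mult.assoc del: of_nat_Suc)
qed

text \<open>
  The factors \<open>\<langle>x, y\<rangle>\<close> of the power are replaced one at a time by arbitrary \<open>\<langle>x\<^sub>i, y\<rangle>\<close>.
\<close>
lemma polarization:
  fixes g :: "'a::euclidean_space \<Rightarrow> complex"
  assumes g: "continuous_on (cbox lo hi) g"
    and zero: "\<And>x. integral (cbox lo hi) (\<lambda>y. g y * of_real (x \<bullet> y) ^ N) = 0"
  shows "integral (cbox lo hi) (\<lambda>y. g y * (\<Prod>i<N. of_real (x i \<bullet> y))) = 0"
proof -
  note [continuous_intros] = g
  have "integral (cbox lo hi) (\<lambda>y. g y * (\<Prod>i<m. of_real (x i \<bullet> y)) * of_real (x' \<bullet> y) ^ (N - m)) = 0"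
    if "m \<le> N" for x :: "nat \<Rightarrow> 'a" and x' m
    using that
  proof (induction m arbitrary: x')
    case (Suc m)
    have "integral (cbox lo hi) (\<lambda>y. (g y * (\<Prod>i<m. of_real (x i \<bullet> y))) * of_real (x m \<bullet> y) * of_real (x' \<bullet> y) ^ (N - Suc m)) = 0"
    proof (rule polarization_step)
      show "integral (cbox lo hi) (\<lambda>y. g y * (\<Prod>i<m. of_real (x i \<bullet> y)) * of_real (x'' \<bullet> y) ^ Suc (N - Suc m)) = 0" for x''
        using Suc.IH[of x''] Suc.prems by (simp add: Suc_diff_Suc)
    qed (intro continuous_intros)
    then show ?case by (simp add: mult_ac)
  qed (simp add: zero)
  from this[of N x] show ?thesis by simp
qed

text \<open>
  Multilinearity: the moments with factors \<open>\<langle>b, y\<rangle>\<close>, where \<open>b\<close> runs through the basis, determine all others. In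
  particular the moments of degree \<open>N\<close> of all functions \<open>g\<close> form a space of finite dimension.
\<close>
lemma moment_expansion:
  fixes g :: "'a::euclidean_space \<Rightarrow> complex" and N :: nat
  assumes g: "continuous_on (cbox lo hi) g" and c: "\<And>i. linear (c i :: 'a \<Rightarrow> complex)"
  shows "integral (cbox lo hi) (\<lambda>y. g y * (\<Prod>i<N. c i y)) =
    (\<Sum>J\<in>PiE {..<N} (\<lambda>_. Basis). integral (cbox lo hi) (\<lambda>y. g y * (\<Prod>i<N. of_real (J i \<bullet> y))) * (\<Prod>i<N. c i (J i)))"
proof -
  note [continuous_intros] = g
  have "c i y = (\<Sum>b\<in>Basis. of_real (b \<bullet> y) * c i b)" for i y
  proof -
    have "c i y = c i (\<Sum>b\<in>Basis. (y \<bullet> b) *\<^sub>R b)" by (simp add: euclidean_representation)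
    also have "\<dots> = (\<Sum>b\<in>Basis. (y \<bullet> b) *\<^sub>R c i b)"
      by (simp add: linear_sum[OF c] linear_scale[OF c])
    finally show ?thesis by (simp add: scaleR_conv_of_real inner_commute)
  qed
  then have "(\<Prod>i<N. c i y) = (\<Prod>i<N. \<Sum>b\<in>Basis. of_real (b \<bullet> y) * c i b)" for y
    by (intro prod.cong refl)
  then have "(\<lambda>y. g y * (\<Prod>i<N. c i y)) = (\<lambda>y. \<Sum>J\<in>PiE {..<N} (\<lambda>_. Basis).
      (g y * (\<Prod>i<N. of_real (J i \<bullet> y))) * (\<Prod>i<N. c i (J i)))"
    by (simp add: fun_eq_iff, subst prod_sum_PiE[OF finite_lessThan finite_Basis]) (simp add: sum_distrib_left prod.distrib mult.assoc)
  then show ?thesis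
    by (simp, subst integral_sum)
      (auto intro!: integrable_continuous continuous_intros sum.cong finite_PiE)
qed

lemma moment_complex_linear:
  fixes g :: "'a::euclidean_space \<Rightarrow> complex" and N :: nat
  assumes g: "continuous_on (cbox lo hi) g" and c: "\<And>i. linear (c i :: 'a \<Rightarrow> complex)"
    and zero: "\<And>x. integral (cbox lo hi) (\<lambda>y. g y * (\<Prod>i<N. of_real (x i \<bullet> y))) = 0"
  shows "integral (cbox lo hi) (\<lambda>y. g y * (\<Prod>i<N. c i y)) = 0"
  by (subst moment_expansion[OF g c]) (simp_all add: zero)

text \<open>
  The class of functions with vanishing moments is closed under multiplication by linear functions, hence by
  polynomials. So \<open>g\<close> is orthogonal to all polynomials, which are dense.
\<close>
lemma zero_if_moments_zero:
  fixes g :: "'a::euclidean_space \<Rightarrow> complex"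
  assumes g: "continuous_on (cbox lo hi) g" and ne: "box lo hi \<noteq> {}"
    and zero: "\<And>(N::nat) x. integral (cbox lo hi) (\<lambda>y. g y * (\<Prod>i<N. of_real (x i \<bullet> y))) = 0"
    and y: "y \<in> cbox lo hi"
  shows "g y = 0"
proof -
  let ?Q = "cbox lo hi"
  define M where "M = {h :: 'a \<Rightarrow> complex. continuous_on ?Q h \<and>
    (\<forall>(N::nat) x. integral ?Q (\<lambda>y. h y * (\<Prod>i<N. of_real (x i \<bullet> y))) = 0)}"
  have M_poly: "(\<lambda>y. h y * of_real (p y)) \<in> M" if "real_polynomial_function p" "h \<in> M" for p h
    using that
  proof (induction p arbitrary: h rule: real_polynomial_function.induct)
    case (linear p)
    have h: "continuous_on ?Q h" and hz: "\<And>(N::nat) x. integral ?Q (\<lambda>y. h y * (\<Prod>i<N. of_real (x i \<bullet> y))) = 0"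
      using linear.prems by (auto simp: M_def)
    have lin: "linear p" using linear.hyps by (rule bounded_linear.linear)
    have p: "continuous_on ?Q p" using linear.hyps by (rule linear_continuous_on)
    have "integral ?Q (\<lambda>y. h y * of_real (p y) * (\<Prod>i<N. of_real (x i \<bullet> y))) = 0" for N :: nat and x
    proof -
      (* The linear function p becomes one more factor of the moment, at position N. *)
      define c where "c i = (\<lambda>y. if i < N then complex_of_real (x i \<bullet> y) else of_real (p y))" for i
      have "linear (c i)" for i
        using lin by (auto simp: c_def linear_iff inner_simps scaleR_conv_of_real)
      from moment_complex_linear[of lo hi h c "Suc N", OF h this hz] show ?thesis
        by (simp add: c_def mult_ac)
    qed
    then show ?case by (auto simp: M_def intro!: continuous_intros h p)
  next
    case (const a)
    have "integral ?Q (\<lambda>y. of_real a * (h y * (\<Prod>i<N. of_real (x i \<bullet> y)))) = 0" for N :: nat and x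
      using const by (subst Henstock_Kurzweil_Integration.integral_mult_right) (simp add: M_def)
    then show ?case
      using const by (auto simp: M_def mult_ac intro!: continuous_intros)
  next
    case (add p q)
    have c: "continuous_on ?Q (\<lambda>y. h y * of_real (p y))" "continuous_on ?Q (\<lambda>y. h y * of_real (q y))"
      using add.IH[OF add.prems] by (auto simp: M_def)
    have "integral ?Q (\<lambda>y. h y * of_real (p y) * (\<Prod>i<N. of_real (x i \<bullet> y)) + h y * of_real (q y) * (\<Prod>i<N. of_real (x i \<bullet> y))) = 0" for N :: nat and x
      using add.IH[OF add.prems] c
      by (subst Henstock_Kurzweil_Integration.integral_add) (auto simp: M_def intro!: integrable_continuous continuous_intros)
    with continuous_on_add[OF c] show ?case by (auto simp: M_def distrib_left distrib_right)
  next
    case (mult p q)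
    from mult.IH(2)[OF mult.IH(1)[OF mult.prems]] show ?case by (simp add: mult_ac)
  qed
  have gM: "g \<in> M" using g zero by (auto simp: M_def)
  have poly0: "integral ?Q (\<lambda>y. g y * of_real (p y)) = 0" if "real_polynomial_function p" for p
    using M_poly[OF that gM] by (auto simp: M_def dest!: spec[of _ 0])
  (* A real function orthogonal to all polynomials is orthogonal to itself, by approximation. *)
  have real0: "u y = 0" if u: "continuous_on ?Q u"
    and up: "\<And>p. real_polynomial_function p \<Longrightarrow> integral ?Q (\<lambda>y. u y * p y) = 0"
    for u :: "'a \<Rightarrow> real"
  proof -
    note [continuous_intros] = u
    let ?A = "integral ?Q (\<lambda>y. \<bar>u y\<bar>)"
    have A: "?A \<ge> 0" by (intro integral_nonneg integrable_continuous continuous_intros) auto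
    have est: "integral ?Q (\<lambda>y. u y * u y) \<le> e * ?A" if e: "e > 0" for e
    proof -
      obtain p where p: "real_polynomial_function p" "\<And>y. y \<in> ?Q \<Longrightarrow> \<bar>u y - p y\<bar> < e"
        using Stone_Weierstrass_real_polynomial_function[OF compact_cbox u e] by blast
      have pc[continuous_intros]: "continuous_on ?Q p"
        using p(1) continuous_on_polymonial_function real_polynomial_function_eq by blast
      have "integral ?Q (\<lambda>y. u y * u y) = integral ?Q (\<lambda>y. u y * u y) - integral ?Q (\<lambda>y. u y * p y)"
        using up[OF p(1)] by simp
      also have "\<dots> = integral ?Q (\<lambda>y. u y * u y - u y * p y)"
        by (intro Henstock_Kurzweil_Integration.integral_diff[symmetric] integrable_continuous continuous_intros)
      also have "\<dots> \<le> integral ?Q (\<lambda>y. e * \<bar>u y\<bar>)"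
      proof (intro integral_le integrable_continuous continuous_intros)
        fix y assume y: "y \<in> ?Q"
        have "u y * u y - u y * p y \<le> \<bar>u y * (u y - p y)\<bar>" by (simp add: algebra_simps)
        also have "\<dots> = \<bar>u y - p y\<bar> * \<bar>u y\<bar>" by (simp add: abs_mult)
        also have "\<dots> \<le> e * \<bar>u y\<bar>" using p(2)[OF y] by (intro mult_right_mono) auto
        finally show "u y * u y - u y * p y \<le> e * \<bar>u y\<bar>" .
      qed
      finally show ?thesis by simp
    qed
    have "integral ?Q (\<lambda>y. u y * u y) \<le> 0"
    proof (rule ccontr)
      assume *: "\<not> ?thesis"
      from est[of "integral ?Q (\<lambda>y. u y * u y) / (2 * (?A + 1))"] * A
      have "integral ?Q (\<lambda>y. u y * u y) \<le> integral ?Q (\<lambda>y. u y * u y) / (2 * (?A + 1)) * ?A" by simp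
      also have "\<dots> = integral ?Q (\<lambda>y. u y * u y) * (?A / (2 * (?A + 1)))" by simp
      also have "\<dots> < integral ?Q (\<lambda>y. u y * u y) * 1"
        using * A by (intro mult_strict_left_mono) (auto simp: field_simps)
      finally show False by simp
    qed
    moreover have "integral ?Q (\<lambda>y. u y * u y) \<ge> 0"
      by (intro integral_nonneg integrable_continuous continuous_intros) auto
    ultimately have "integral ?Q (\<lambda>y. u y * u y) = 0" by simp
    then show "u y = 0"
      using y by (subst (asm) integral_cbox_eq_0_iff) (auto intro!: continuous_intros ne)
  qed
  have int: "(\<lambda>y. g y * of_real (p y)) integrable_on ?Q" if "real_polynomial_function p" for p
    using M_poly[OF that gM] by (auto simp: M_def intro: integrable_continuous)
  have "Re (g y) = 0"
  proof (rule real0)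
    fix p :: "'a \<Rightarrow> real" assume p: "real_polynomial_function p"
    show "integral ?Q (\<lambda>y. Re (g y) * p y) = 0"
      using integral_linear[OF int[OF p] bounded_linear_Re] poly0[OF p] by (simp add: o_def)
  qed (intro continuous_intros g)
  moreover have "Im (g y) = 0"
  proof (rule real0)
    fix p :: "'a \<Rightarrow> real" assume p: "real_polynomial_function p"
    show "integral ?Q (\<lambda>y. Im (g y) * p y) = 0"
      using integral_linear[OF int[OF p] bounded_linear_Im] poly0[OF p] by (simp add: o_def)
  qed (intro continuous_intros g)
  ultimately show ?thesis by (simp add: complex_eq_iff)
qed

section \<open>Harmonic polynomials given by moments\<close>

lemma finite_multiindex: "finite {\<alpha>::'n::finite \<Rightarrow> nat. sum \<alpha> UNIV = p}"
proof (rule finite_subset)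
  show "{\<alpha>::'n \<Rightarrow> nat. sum \<alpha> UNIV = p} \<subseteq> PiE UNIV (\<lambda>_. {..p})"
    by (auto simp: PiE_def extensional_def intro!: member_le_sum)
qed (intro finite_PiE, auto)

text \<open>
  The power is a sum over all maps from \<open>{..<p}\<close> to the index set; maps with the same fibre sizes \<open>\<alpha>\<close> give the
  same monomial, and their number is its coefficient.
\<close>
lemma multinomial_expansion:
  obtains m :: "('n::finite \<Rightarrow> nat) \<Rightarrow> complex"
  where "\<And>t. (\<Sum>j\<in>UNIV. t j) ^ p = (\<Sum>\<alpha> | sum \<alpha> UNIV = p. m \<alpha> * (\<Prod>j\<in>UNIV. t j ^ \<alpha> j))"
proof
  let ?P = "PiE {..<p} (\<lambda>_. UNIV :: 'n set)"
  define cnt where "cnt J j = card {i\<in>{..<p}. J i = j}" for J :: "nat \<Rightarrow> 'n" and j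
  define m :: "('n \<Rightarrow> nat) \<Rightarrow> complex" where "m \<alpha> = of_nat (card {J\<in>?P. cnt J = \<alpha>})" for \<alpha>
  fix t :: "'n \<Rightarrow> complex"
  have prod: "(\<Prod>i<p. t (J i)) = (\<Prod>j\<in>UNIV. t j ^ cnt J j)" for J :: "nat \<Rightarrow> 'n"
  proof -
    have "(\<Prod>i<p. t (J i)) = (\<Prod>j\<in>UNIV. \<Prod>i\<in>{i\<in>{..<p}. J i = j}. t (J i))"
      by (rule prod.group[symmetric]) auto
    also have "\<dots> = (\<Prod>j\<in>UNIV. t j ^ cnt J j)"
      by (intro prod.cong refl) (simp add: cnt_def)
    finally show ?thesis .
  qed
  have cnt: "sum (cnt J) UNIV = p" for J
  proof -
    have "(\<Sum>i<p. 1::nat) = (\<Sum>j\<in>UNIV. \<Sum>i\<in>{i\<in>{..<p}. J i = j}. 1)"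
      by (rule sum.group[symmetric]) auto
    then show ?thesis by (simp add: cnt_def)
  qed
  have "(\<Sum>j\<in>UNIV. t j) ^ p = (\<Prod>i<p. \<Sum>j\<in>UNIV. t j)" by simp
  also have "\<dots> = (\<Sum>J\<in>?P. \<Prod>i<p. t (J i))" by (subst prod_sum_PiE) auto
  also have "\<dots> = (\<Sum>\<alpha> | sum \<alpha> UNIV = p. \<Sum>J\<in>{J\<in>?P. cnt J = \<alpha>}. \<Prod>i<p. t (J i))"
  proof (rule sum.group[symmetric])
    show "finite ?P" by (intro finite_PiE) auto
    show "cnt ` ?P \<subseteq> {\<alpha>. sum \<alpha> UNIV = p}" using cnt by blast
  qed (rule finite_multiindex)
  also have "\<dots> = (\<Sum>\<alpha> | sum \<alpha> UNIV = p. m \<alpha> * (\<Prod>j\<in>UNIV. t j ^ \<alpha> j))"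
    by (intro sum.cong refl) (auto simp: prod m_def)
  finally show "(\<Sum>j\<in>UNIV. t j) ^ p = (\<Sum>\<alpha> | sum \<alpha> UNIV = p. m \<alpha> * (\<Prod>j\<in>UNIV. t j ^ \<alpha> j))" .
qed

text \<open>
  The Hermitian form of \<open>\<complex>\<^sup>n\<close>. Its real part is the real inner product, so that powers of the inner product split
  into products of powers of \<open>hdot x y\<close> and of its conjugate, which are bigraded polynomials in \<open>x\<close>.
\<close>
definition hdot :: "complex ^ 'n \<Rightarrow> complex ^ 'n::finite \<Rightarrow> complex"
  where "hdot x y = (\<Sum>j\<in>UNIV. x $ j * cnj (y $ j))"

lemma Re_hdot: "Re (hdot x y) = x \<bullet> y"
  by (simp add: hdot_def inner_vec_def inner_complex_def)

lemma Im_hdot: "Im (hdot x y) = x \<bullet> (\<i> *s y)"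
  by (simp add: hdot_def inner_vec_def inner_complex_def algebra_simps)

lemma hdot_add_left: "hdot (x + x') y = hdot x y + hdot x' y"
  by (simp add: hdot_def distrib_right sum.distrib)

lemma hdot_scaleR_left: "hdot (t *\<^sub>R x) y = of_real t * hdot x y"
  by (simp add: hdot_def sum_distrib_left scaleR_conv_of_real[where 'a=complex] mult.assoc)

lemma hdot_mult_left: "hdot (c *s x) y = c * hdot x y"
  by (simp add: hdot_def sum_distrib_left mult.assoc)

lemma linear_hdot: "linear (hdot x)"
  by (rule linearI) (simp_all add: hdot_def distrib_left sum.distrib sum_distrib_left scaleR_conv_of_real[where 'a=complex] mult_ac)

lemma linear_cnj_hdot: "linear (\<lambda>y. cnj (hdot x y))"
  by (rule linearI)
    (simp_all add: linear_add[OF linear_hdot] linear_scale[OF linear_hdot] scaleR_conv_of_real[where 'a=complex])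

lemma continuous_on_hdot [continuous_intros]:
  "continuous_on S h \<Longrightarrow> continuous_on S (\<lambda>t. hdot x (h t))"
  by (rule continuous_on_compose2[OF linear_continuous_on[OF linear_conv_bounded_linear[THEN iffD1, OF linear_hdot]]]) auto

text \<open>
  The orthogonal vectors \<open>y\<close> and \<open>i y\<close> of equal length are represented by the real and imaginary part of
  \<open>b \<mapsto> hdot b y\<close>.
\<close>
lemma sum_Basis_hdot_squared: "(\<Sum>b\<in>Basis. hdot b y * hdot b y) = 0"
proof -
  have "hdot b y * hdot b y = of_real ((y \<bullet> b) * (y \<bullet> b)) - of_real (((\<i> *s y) \<bullet> b) * ((\<i> *s y) \<bullet> b))
     + 2 * \<i> * of_real ((y \<bullet> b) * ((\<i> *s y) \<bullet> b))" for b
    by (simp add: complex_eq_iff Re_hdot Im_hdot inner_commute)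
  then have "(\<Sum>b\<in>Basis. hdot b y * hdot b y)
      = of_real (y \<bullet> y) - of_real ((\<i> *s y) \<bullet> (\<i> *s y)) + 2 * \<i> * of_real (y \<bullet> (\<i> *s y))"
    by (simp only: sum.distrib sum_subtractf flip: of_real_sum euclidean_inner sum_distrib_left)
  also have "(\<i> *s y) \<bullet> (\<i> *s y) = y \<bullet> y" by (simp add: inner_vec_def inner_complex_def algebra_simps)
  also have "y \<bullet> (\<i> *s y) = 0" by (simp add: inner_vec_def inner_complex_def algebra_simps)
  finally show ?thesis by simp
qed

lemma sum_Basis_hdot_cnj: "(\<Sum>b\<in>Basis. hdot b y * cnj (hdot b y)) = of_real (2 * (y \<bullet> y))"
proof -
  have "hdot b y * cnj (hdot b y) = of_real ((y \<bullet> b) * (y \<bullet> b)) + of_real (((\<i> *s y) \<bullet> b) * ((\<i> *s y) \<bullet> b))" for b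
    by (simp add: complex_eq_iff Re_hdot Im_hdot inner_commute)
  then have "(\<Sum>b\<in>Basis. hdot b y * cnj (hdot b y)) = of_real (y \<bullet> y) + of_real ((\<i> *s y) \<bullet> (\<i> *s y))"
    by (simp only: sum.distrib flip: of_real_sum euclidean_inner)
  also have "(\<i> *s y) \<bullet> (\<i> *s y) = y \<bullet> y" by (simp add: inner_vec_def inner_complex_def algebra_simps)
  finally show ?thesis by simp
qed

definition bigraded_moment ::
    "(complex ^ 'n::finite) set \<Rightarrow> (complex ^ 'n \<Rightarrow> complex) \<Rightarrow> nat \<Rightarrow> nat \<Rightarrow> complex ^ 'n \<Rightarrow> complex"
  where "bigraded_moment Q g p q x = integral Q (\<lambda>y. g y * hdot x y ^ p * cnj (hdot x y) ^ q)"

text \<open>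
  The two factors are treated as independent complex variables, which makes the integrand a polynomial in \<open>t\<close>
  with complex coefficients.
\<close>
lemma bigraded_moment_derivative:
  fixes g :: "complex ^ 'n::finite \<Rightarrow> complex"
  assumes g: "continuous_on (cbox lo hi) g"
  shows "((\<lambda>t. bigraded_moment (cbox lo hi) g p q (x + t *\<^sub>R b)) has_vector_derivative
    of_nat p * bigraded_moment (cbox lo hi) (\<lambda>y. g y * hdot b y) (p - 1) q x
    + of_nat q * bigraded_moment (cbox lo hi) (\<lambda>y. g y * cnj (hdot b y)) p (q - 1) x) (at 0)"
proof -
  let ?Q = "cbox lo hi"
  note [continuous_intros] = g continuous_on_compose2[OF g, where f=snd]
  let ?a = "\<lambda>t y. hdot x y + of_real t * hdot b y"
  let ?a' = "\<lambda>t y. cnj (hdot x y) + of_real t * cnj (hdot b y)"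
  let ?D = "\<lambda>t y. of_nat p * (g y * hdot b y * ?a t y ^ (p - 1) * ?a' t y ^ q)
      + of_nat q * (g y * cnj (hdot b y) * ?a t y ^ p * ?a' t y ^ (q - 1))"
  have "((\<lambda>t. integral ?Q (\<lambda>y. g y * ?a t y ^ p * ?a' t y ^ q)) has_vector_derivative
      integral ?Q (?D 0)) (at 0 within UNIV)"
  proof (rule leibniz_rule_vector_derivative)
    fix t y
    have "((\<lambda>z. g y * (hdot x y + z * hdot b y) ^ p * (cnj (hdot x y) + z * cnj (hdot b y)) ^ q)
      has_field_derivative ?D t y) (at (of_real t))"
      by (rule derivative_eq_intros refl | simp add: algebra_simps)+
    from has_vector_derivative_real_field[OF this]
    show "((\<lambda>t. g y * ?a t y ^ p * ?a' t y ^ q) has_vector_derivative ?D t y) (at t within UNIV)" .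
  next
    show "continuous_on (UNIV \<times> ?Q) (\<lambda>(t, y). ?D t y)"
      unfolding split_beta by (intro continuous_intros) auto
  qed (auto intro!: integrable_continuous continuous_intros)
  also have "integral ?Q (?D 0) =
      of_nat p * bigraded_moment ?Q (\<lambda>y. g y * hdot b y) (p - 1) q x
    + of_nat q * bigraded_moment ?Q (\<lambda>y. g y * cnj (hdot b y)) p (q - 1) x"
    unfolding bigraded_moment_def
    by (subst Henstock_Kurzweil_Integration.integral_add) (auto intro!: integrable_continuous continuous_intros)
  finally show ?thesis
    by (simp add: bigraded_moment_def hdot_add_left hdot_scaleR_left)
qed

lemma bigraded_moment_sum:
  fixes h :: "'i \<Rightarrow> complex ^ 'n::finite \<Rightarrow> complex"
  assumes "finite B" "\<And>b. b \<in> B \<Longrightarrow> continuous_on (cbox lo hi) (h b)"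
  shows "(\<Sum>b\<in>B. bigraded_moment (cbox lo hi) (h b) p q x)
    = bigraded_moment (cbox lo hi) (\<lambda>y. \<Sum>b\<in>B. h b y) p q x"
  unfolding bigraded_moment_def sum_distrib_right
  using assms by (subst integral_sum) (auto intro!: integrable_continuous continuous_intros)

text \<open>
  Two derivatives in direction \<open>b\<close> produce the factors \<open>h\<^sup>2\<close>, \<open>\<bar>h\<bar>\<^sup>2\<close> and the conjugate of \<open>h\<^sup>2\<close> with \<open>h = hdot b y\<close>. In the
  sum over the basis only \<open>\<bar>h\<bar>\<^sup>2\<close> survives and gives \<open>2 \<bar>y\<bar>\<^sup>2\<close>.
\<close>
lemma laplacian_bigraded_moment:
  fixes g :: "complex ^ 'n::finite \<Rightarrow> complex"
  assumes g: "continuous_on (cbox lo hi) g"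
  shows "laplacian (bigraded_moment (cbox lo hi) g p q) x =
    of_nat (4 * p * q) * bigraded_moment (cbox lo hi) (\<lambda>y. g y * of_real (y \<bullet> y)) (p - 1) (q - 1) x"
proof -
  let ?Q = "cbox lo hi"
  let ?M = "bigraded_moment ?Q"
  note [continuous_intros] = g
  have D1: "dir_deriv (?M g p q) b = (\<lambda>x. of_nat p * ?M (\<lambda>y. g y * hdot b y) (p - 1) q x
    + of_nat q * ?M (\<lambda>y. g y * cnj (hdot b y)) p (q - 1) x)" for b
    unfolding dir_deriv_def fun_eq_iff by (intro allI vector_derivative_at bigraded_moment_derivative[OF g])
  have D2: "dir_deriv (\<lambda>y. dir_deriv (?M g p q) b y) b x =
      (of_nat p * of_nat (p - 1)) * ?M (\<lambda>y. g y * hdot b y * hdot b y) (p - 1 - 1) q x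
    + (2 * of_nat p * of_nat q) * ?M (\<lambda>y. g y * hdot b y * cnj (hdot b y)) (p - 1) (q - 1) x
    + (of_nat q * of_nat (q - 1)) * ?M (\<lambda>y. g y * cnj (hdot b y) * cnj (hdot b y)) p (q - 1 - 1) x" for b
  proof -
    have "((\<lambda>t. of_nat p * ?M (\<lambda>y. g y * hdot b y) (p - 1) q (x + t *\<^sub>R b)
      + of_nat q * ?M (\<lambda>y. g y * cnj (hdot b y)) p (q - 1) (x + t *\<^sub>R b)) has_vector_derivative
      of_nat p * (of_nat (p - 1) * ?M (\<lambda>y. g y * hdot b y * hdot b y) (p - 1 - 1) q x
        + of_nat q * ?M (\<lambda>y. g y * hdot b y * cnj (hdot b y)) (p - 1) (q - 1) x)
      + of_nat q * (of_nat p * ?M (\<lambda>y. g y * cnj (hdot b y) * hdot b y) (p - 1) (q - 1) x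
        + of_nat (q - 1) * ?M (\<lambda>y. g y * cnj (hdot b y) * cnj (hdot b y)) p (q - 1 - 1) x)) (at 0)"
      by (intro has_vector_derivative_add has_vector_derivative_mult_right bigraded_moment_derivative continuous_intros)
    then show ?thesis
      unfolding D1 unfolding dir_deriv_def
      by (intro vector_derivative_at) (simp add: algebra_simps)
  qed
  have s1: "(\<lambda>y. \<Sum>b\<in>Basis. g y * hdot b y * hdot b y) = (\<lambda>_. 0)"
    by (simp add: mult.assoc sum_Basis_hdot_squared flip: sum_distrib_left)
  have s2: "(\<lambda>y. \<Sum>b\<in>Basis. g y * hdot b y * cnj (hdot b y)) = (\<lambda>y. 2 * (g y * of_real (y \<bullet> y)))"
    by (simp add: mult.assoc sum_Basis_hdot_cnj mult.left_commute[of _ 2] flip: sum_distrib_left)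
  have "(\<Sum>b\<in>Basis. cnj (hdot b y) * cnj (hdot b y)) = 0" for y :: "complex ^ 'n"
    using arg_cong[OF sum_Basis_hdot_squared[of y], of cnj] by simp
  then have s3: "(\<lambda>y. \<Sum>b\<in>Basis. g y * cnj (hdot b y) * cnj (hdot b y)) = (\<lambda>_. 0)"
    by (simp only: mult.assoc mult_zero_right flip: sum_distrib_left)
  have "laplacian (?M g p q) x =
      (of_nat p * of_nat (p - 1)) * (\<Sum>b\<in>Basis. ?M (\<lambda>y. g y * hdot b y * hdot b y) (p - 1 - 1) q x)
    + (2 * of_nat p * of_nat q) * (\<Sum>b\<in>Basis. ?M (\<lambda>y. g y * hdot b y * cnj (hdot b y)) (p - 1) (q - 1) x)
    + (of_nat q * of_nat (q - 1)) * (\<Sum>b\<in>Basis. ?M (\<lambda>y. g y * cnj (hdot b y) * cnj (hdot b y)) p (q - 1 - 1) x)"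
    unfolding laplacian_def D2 by (simp only: sum.distrib sum_distrib_left)
  also have "\<dots> = (2 * of_nat p * of_nat q) * ?M (\<lambda>y. 2 * (g y * of_real (y \<bullet> y))) (p - 1) (q - 1) x"
    by (subst (1 2 3) bigraded_moment_sum)
      (auto simp: s1 s2 s3 intro!: continuous_intros, simp_all add: bigraded_moment_def)
  also have "?M (\<lambda>y. 2 * (g y * of_real (y \<bullet> y))) (p - 1) (q - 1) x
      = 2 * ?M (\<lambda>y. g y * of_real (y \<bullet> y)) (p - 1) (q - 1) x"
    by (simp add: bigraded_moment_def mult.assoc)
  finally show ?thesis by (simp add: mult_ac)
qed

text \<open>
  Expanding both powers separates the variable \<open>x\<close> from \<open>y\<close>, so that the coefficients are moments of \<open>g\<close>.
\<close>
lemma bigraded_moment_is_poly: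
  fixes g :: "complex ^ 'n::finite \<Rightarrow> complex"
  assumes g: "continuous_on (cbox lo hi) g"
  shows "\<exists>c. bigraded_moment (cbox lo hi) g p q = bigraded_poly p q c"
proof -
  let ?Q = "cbox lo hi"
  note [continuous_intros] = g
  obtain m :: "('n \<Rightarrow> nat) \<Rightarrow> complex" where m: "\<And>t. (\<Sum>j\<in>UNIV. t j) ^ p
      = (\<Sum>\<alpha> | sum \<alpha> UNIV = p. m \<alpha> * (\<Prod>j\<in>UNIV. t j ^ \<alpha> j))"
    by (rule multinomial_expansion[of p]) blast
  obtain m' :: "('n \<Rightarrow> nat) \<Rightarrow> complex" where m': "\<And>t. (\<Sum>j\<in>UNIV. t j) ^ q
      = (\<Sum>\<beta> | sum \<beta> UNIV = q. m' \<beta> * (\<Prod>j\<in>UNIV. t j ^ \<beta> j))"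
    by (rule multinomial_expansion[of q]) blast
  define c where "c \<alpha> \<beta> = integral ?Q (\<lambda>y. g y * (m \<alpha> * (\<Prod>j\<in>UNIV. cnj (y $ j) ^ \<alpha> j)) *
      (m' \<beta> * (\<Prod>j\<in>UNIV. (y $ j) ^ \<beta> j)))" for \<alpha> \<beta>
  have "bigraded_moment ?Q g p q x = bigraded_poly p q c x" for x
  proof -
    have "g y * hdot x y ^ p * cnj (hdot x y) ^ q = (\<Sum>\<alpha> | sum \<alpha> UNIV = p. \<Sum>\<beta> | sum \<beta> UNIV = q.
        (g y * (m \<alpha> * (\<Prod>j\<in>UNIV. cnj (y $ j) ^ \<alpha> j)) * (m' \<beta> * (\<Prod>j\<in>UNIV. (y $ j) ^ \<beta> j)))
        * (\<Prod>j\<in>UNIV. (x $ j) ^ \<alpha> j) * (\<Prod>j\<in>UNIV. cnj (x $ j) ^ \<beta> j))" for y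
    proof -
      have "cnj (hdot x y) = (\<Sum>j\<in>UNIV. cnj (x $ j) * y $ j)" by (simp add: hdot_def)
      then have "cnj (hdot x y) ^ q = (\<Sum>\<beta> | sum \<beta> UNIV = q. m' \<beta> * (\<Prod>j\<in>UNIV. (cnj (x $ j) * y $ j) ^ \<beta> j))"
        by (simp only: m')
      moreover have "hdot x y ^ p = (\<Sum>\<alpha> | sum \<alpha> UNIV = p. m \<alpha> * (\<Prod>j\<in>UNIV. (x $ j * cnj (y $ j)) ^ \<alpha> j))"
        unfolding hdot_def by (rule m)
      ultimately have "g y * hdot x y ^ p * cnj (hdot x y) ^ q = (\<Sum>\<alpha> | sum \<alpha> UNIV = p. \<Sum>\<beta> | sum \<beta> UNIV = q.
        g y * ((m \<alpha> * (\<Prod>j\<in>UNIV. (x $ j * cnj (y $ j)) ^ \<alpha> j)) * (m' \<beta> * (\<Prod>j\<in>UNIV. (cnj (x $ j) * y $ j) ^ \<beta> j))))"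
        by (simp only: mult.assoc[of "g y"] sum_product) (simp only: sum_distrib_left)
      also have "\<dots> = (\<Sum>\<alpha> | sum \<alpha> UNIV = p. \<Sum>\<beta> | sum \<beta> UNIV = q.
        (g y * (m \<alpha> * (\<Prod>j\<in>UNIV. cnj (y $ j) ^ \<alpha> j)) * (m' \<beta> * (\<Prod>j\<in>UNIV. (y $ j) ^ \<beta> j)))
        * (\<Prod>j\<in>UNIV. (x $ j) ^ \<alpha> j) * (\<Prod>j\<in>UNIV. cnj (x $ j) ^ \<beta> j))"
        by (intro sum.cong refl) (simp only: power_mult_distrib prod.distrib mult_ac)
      finally show ?thesis .
    qed
    then show ?thesis
      unfolding bigraded_moment_def bigraded_poly_def c_def integral_mult_left[symmetric]
      by (simp add: integral_sum finite_multiindex integrable_continuous continuous_intros)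
  qed
  then show ?thesis by blast
qed

lemma prod_two_factors:
  fixes a b :: "'a::comm_monoid_mult"
  shows "(\<Prod>i<m + n. if i < m then a else b) = a ^ m * b ^ n"
  by (induction n) (simp_all add: mult_ac)

text \<open>
  The moment splits by \<open>2 \<langle>x, y\<rangle> = h + cnj h\<close>, \<open>h = hdot x y\<close>, into bigraded moments. Rotating \<open>k \<in> K\<close> by unit complex
  numbers separates them, so each vanishes on \<open>K\<close>. Each is harmonic because its Laplacian carries the factor \<open>\<bar>y\<bar>\<^sup>2\<close>
  under the integral and is zero by the hypothesis on degree \<open>N - 2\<close>. A non-harmonic cone then forces it to be zero.
\<close>
lemma moment_zero_if_zero_on_cone:
  fixes g :: "complex ^ 'n::finite \<Rightarrow> complex"
  assumes cone: "is_complex_cone K" and nh: "non_harmonic K"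
    and g: "continuous_on (cbox lo hi) g"
    and low: "\<And>x. 2 \<le> N \<Longrightarrow>
      integral (cbox lo hi) (\<lambda>y. g y * of_real (y \<bullet> y) * (\<Prod>i<N - 2. of_real (x i \<bullet> y))) = 0"
    and zero: "\<And>k. k \<in> K \<Longrightarrow> integral (cbox lo hi) (\<lambda>y. g y * of_real (k \<bullet> y) ^ N) = 0"
  shows "integral (cbox lo hi) (\<lambda>y. g y * of_real (x \<bullet> y) ^ N) = 0"
proof -
  let ?Q = "cbox lo hi"
  let ?M = "bigraded_moment ?Q g"
  note [continuous_intros] = g
  have expand: "of_real (2 ^ N) * integral ?Q (\<lambda>y. g y * of_real ((c *s x) \<bullet> y) ^ N)
    = (\<Sum>p\<le>N. of_nat (N choose p) * c ^ p * cnj c ^ (N - p) * ?M p (N - p) x)" for c x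
  proof -
    have "of_real (2 ^ N) * (g y * of_real ((c *s x) \<bullet> y) ^ N) = (\<Sum>p\<le>N.
      of_nat (N choose p) * c ^ p * cnj c ^ (N - p) * (g y * hdot x y ^ p * cnj (hdot x y) ^ (N - p)))" for y
    proof -
      have "of_real (2 * ((c *s x) \<bullet> y)) = c * hdot x y + cnj c * cnj (hdot x y)"
        using complex_add_cnj[of "c * hdot x y"] by (simp add: hdot_mult_left flip: Re_hdot)
      then have "of_real (2 ^ N) * (g y * of_real ((c *s x) \<bullet> y) ^ N) = g y * (c * hdot x y + cnj c * cnj (hdot x y)) ^ N"
        by (metis (no_types, lifting) mult.left_commute of_real_mult of_real_power power_mult_distrib)
      then show ?thesis
        by (simp add: binomial_ring sum_distrib_left power_mult_distrib mult_ac)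
    qed
    then show ?thesis
      unfolding bigraded_moment_def integral_mult_right[symmetric]
      by (simp add: integral_sum integrable_continuous continuous_intros)
  qed
  have on_K: "?M p (N - p) k = 0" if k: "k \<in> K" and p: "p \<le> N" for k p
  proof -
    (* A point z of this arc is the square of a unit number c, and c^N times the moment at c k is a polynomial in z. *)
    have "infinite (cis ` {0..pi})"
    proof
      assume "finite (cis ` {0..pi})"
      then have "finite (Re ` cis ` {0..pi})" by simp
      then have "finite (cos ` {0..pi})" by (simp add: image_image)
      moreover have "inj_on cos {0..pi}" by (auto intro!: inj_onI cos_inj_pi)
      ultimately show False using pi_gt_zero by (simp add: finite_image_iff infinite_Icc)
    qed
    moreover have "(\<Sum>p\<le>N. (of_nat (N choose p) * ?M p (N - p) k) * z ^ p) = 0" if "z \<in> cis ` {0..pi}" for z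
    proof -
      from that obtain s where s: "z = cis s" by blast
      define c where "c = cis (s / 2)"
      have cc: "c * cnj c = 1" and c2: "c * c = z" by (simp_all add: c_def s cis_cnj cis_mult)
      have "c *s k \<in> K" using cone k by (auto simp: is_complex_cone_def)
      from zero[OF this] expand[of c k]
      have "0 = c ^ N * (\<Sum>p\<le>N. of_nat (N choose p) * c ^ p * cnj c ^ (N - p) * ?M p (N - p) k)" by simp
      also have "\<dots> = (\<Sum>p\<le>N. (of_nat (N choose p) * ?M p (N - p) k) * z ^ p)"
        unfolding sum_distrib_left
      proof (intro sum.cong refl)
        fix p assume "p \<in> {..N}"
        then have "c ^ N = c ^ p * c ^ (N - p)" by (simp flip: power_add)
        then have "c ^ N * (c ^ p * cnj c ^ (N - p)) = (c * c) ^ p * (c * cnj c) ^ (N - p)"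
          by (simp add: power_mult_distrib mult_ac)
        then have "c ^ N * (c ^ p * cnj c ^ (N - p)) = z ^ p" by (simp add: cc c2)
        then show "c ^ N * (of_nat (N choose p) * c ^ p * cnj c ^ (N - p) * ?M p (N - p) k)
          = of_nat (N choose p) * ?M p (N - p) k * z ^ p" by (simp add: mult_ac)
      qed
      finally show ?thesis by simp
    qed
    ultimately have "of_nat (N choose p) * ?M p (N - p) k = 0"
      using p by (rule polynomial_vanishing_on_infinite[where n=N and d="\<lambda>p. of_nat (N choose p) * ?M p (N - p) k"])
    then show ?thesis using p by simp
  qed
  have "?M p (N - p) x = 0" if p: "p \<le> N" for p
  proof -
    obtain c where c: "?M p (N - p) = bigraded_poly p (N - p) c"
      using bigraded_moment_is_poly[OF g] by blast
    have "laplacian (?M p (N - p)) x = 0" for x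
    proof (cases "p = 0 \<or> N - p = 0")
      case False
      (* The integrand of the Laplacian as a product of N - 2 real-linear factors. *)
      define d where "d i = (if i < p - 1 then hdot x else (\<lambda>y. cnj (hdot x y)))" for i
      have "integral ?Q (\<lambda>y. (g y * of_real (y \<bullet> y)) * (\<Prod>i<(p - 1) + (N - p - 1). d i y)) = 0"
      proof (rule moment_complex_linear)
        show "linear (d i)" for i by (simp add: d_def linear_hdot linear_cnj_hdot)
        have "(p - 1) + (N - p - 1) = N - 2" "2 \<le> N" using False by auto
        then show "integral ?Q (\<lambda>y. g y * of_real (y \<bullet> y) * (\<Prod>i<(p - 1) + (N - p - 1). of_real (x i \<bullet> y))) = 0" for x
          using low by simp
      qed (intro continuous_intros)
      moreover have "(\<Prod>i<(p - 1) + (N - p - 1). d i y) = hdot x y ^ (p - 1) * cnj (hdot x y) ^ (N - p - 1)" for y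
        unfolding d_def if_distribR by (rule prod_two_factors)
      ultimately show ?thesis
        by (simp add: laplacian_bigraded_moment[OF g]) (simp add: bigraded_moment_def mult.assoc)
    qed (auto simp: laplacian_bigraded_moment[OF g])
    then have "harmonic_fun (bigraded_poly p (N - p) c)" by (simp add: harmonic_fun_def flip: c)
    moreover have "K \<subseteq> {z. bigraded_poly p (N - p) c z = 0}" using on_K[OF _ p] by (auto simp flip: c)
    ultimately have "bigraded_poly p (N - p) c = (\<lambda>_. 0)" using nh unfolding non_harmonic_def by blast
    then show ?thesis by (simp add: c)
  qed
  then have "of_real (2 ^ N) * integral ?Q (\<lambda>y. g y * of_real ((1 *s x) \<bullet> y) ^ N) = (0 :: complex)"
    unfolding expand by simp
  then show ?thesis by simp
qed

section \<open>Truncated powers\<close>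

text \<open>
  The truncated powers, normalized so that from exponent 1 on each is the derivative of the next one.
\<close>
definition ramp :: "nat \<Rightarrow> real \<Rightarrow> real"
  where "ramp j s = max 0 s ^ j / fact j"

lemma continuous_on_ramp [continuous_intros]:
  "continuous_on S h \<Longrightarrow> continuous_on S (\<lambda>x. ramp j (h x))"
  unfolding ramp_def by (intro continuous_intros) auto

lemma ramp_nonpos: "s \<le> 0 \<Longrightarrow> 0 < j \<Longrightarrow> ramp j s = 0"
  by (simp add: ramp_def)

lemma mult_ramp: "0 < j \<Longrightarrow> s * ramp j s = of_nat (Suc j) * ramp (Suc j) s"
proof -
  have "of_nat (Suc j) * (x / fact (Suc j)) = x / fact j" for x :: real
    unfolding fact_Suc by (simp add: divide_simps del: of_nat_Suc)
  then show "0 < j \<Longrightarrow> s * ramp j s = of_nat (Suc j) * ramp (Suc j) s"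
    by (cases "0 \<le> s") (simp_all add: ramp_def del: fact_Suc of_nat_Suc)
qed

lemma ramp_derivative: "(ramp (Suc (Suc j)) has_real_derivative ramp (Suc j) s) (at s)"
proof -
  consider "s > 0" | "s < 0" | "s = 0" by linarith
  then show ?thesis
  proof cases
    case 1
    have "((\<lambda>s. s ^ Suc (Suc j) / fact (Suc (Suc j))) has_real_derivative
        of_nat (Suc (Suc j)) * s ^ Suc j / fact (Suc (Suc j))) (at s)"
      by (rule derivative_eq_intros refl | simp)+
    also have "of_nat (Suc (Suc j)) * s ^ Suc j / fact (Suc (Suc j)) = ramp (Suc j) s"
      using 1 by (simp add: ramp_def divide_simps del: of_nat_Suc)
    finally show ?thesis
      by (rule has_field_derivative_transform_within_open[of _ _ _ "{0<..}"]) (use 1 in \<open>auto simp: ramp_def\<close>)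
  next
    case 2
    have "((\<lambda>s. 0) has_real_derivative 0) (at s)" by simp
    then have "(ramp (Suc (Suc j)) has_real_derivative 0) (at s)"
      by (rule has_field_derivative_transform_within_open[of _ _ _ "{..<0}"]) (use 2 in \<open>auto simp: ramp_nonpos\<close>)
    with 2 show ?thesis by (simp add: ramp_nonpos)
  next
    case 3
    have "((\<lambda>h. (ramp (Suc (Suc j)) h - ramp (Suc (Suc j)) 0) / h) \<longlongrightarrow> 0) (at 0)"
    proof (rule Lim_null_comparison)
      have "norm ((ramp (Suc (Suc j)) h - ramp (Suc (Suc j)) 0) / h) \<le> \<bar>h\<bar> ^ Suc j" for h
      proof (cases "h > 0")
        case True
        have "h ^ Suc j / fact (Suc (Suc j)) \<le> h ^ Suc j / 1"
          using True by (intro divide_left_mono) (auto simp del: fact_Suc)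
        moreover have "(ramp (Suc (Suc j)) h - ramp (Suc (Suc j)) 0) / h = h ^ Suc j / fact (Suc (Suc j))"
          using True by (simp add: ramp_def divide_simps del: fact_Suc)
        ultimately show ?thesis using True by (simp del: fact_Suc)
      next
        case False
        then have "norm ((ramp (Suc (Suc j)) h - ramp (Suc (Suc j)) 0) / h) = 0" by (simp add: ramp_nonpos)
        then show ?thesis using zero_le_power[OF abs_ge_zero[of h], of "Suc j"] by linarith
      qed
      then show "\<forall>\<^sub>F h in at 0. norm ((ramp (Suc (Suc j)) h - ramp (Suc (Suc j)) 0) / h) \<le> \<bar>h\<bar> ^ Suc j" by simp
      have "((\<lambda>h::real. \<bar>h\<bar> ^ Suc j) \<longlongrightarrow> \<bar>0\<bar> ^ Suc j) (at 0)" by (intro tendsto_intros)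
      then show "((\<lambda>h::real. \<bar>h\<bar> ^ Suc j) \<longlongrightarrow> 0) (at 0)" by simp
    qed
    then show ?thesis using 3 by (simp add: has_field_derivative_iff ramp_nonpos)
  qed
qed

text \<open>
  Integrals against truncated powers of \<open>t - r\<close> are successive primitives of one another as functions of \<open>t\<close>.
\<close>
lemma ramp_integral_derivative:
  fixes c :: "'a::euclidean_space \<Rightarrow> complex"
  assumes c: "continuous_on (cbox lo hi) c" and r: "continuous_on (cbox lo hi) r"
  shows "((\<lambda>t. integral (cbox lo hi) (\<lambda>y. c y * of_real (ramp (Suc (Suc j)) (t - r y)))) has_vector_derivative
    integral (cbox lo hi) (\<lambda>y. c y * of_real (ramp (Suc j) (t - r y)))) (at t)"
proof -
  note [continuous_intros] = c r continuous_on_compose2[OF c, where f=snd] continuous_on_compose2[OF r, where f=snd]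
  have "((\<lambda>t. integral (cbox lo hi) (\<lambda>y. c y * of_real (ramp (Suc (Suc j)) (t - r y)))) has_vector_derivative
    integral (cbox lo hi) (\<lambda>y. c y * of_real (ramp (Suc j) (t - r y)))) (at t within UNIV)"
  proof (rule leibniz_rule_vector_derivative)
    fix t y
    have "((\<lambda>t. ramp (Suc (Suc j)) (t - r y)) has_real_derivative ramp (Suc j) (t - r y) * (1 - 0)) (at t)"
      by (rule DERIV_chain2[OF ramp_derivative]) (intro derivative_intros)
    then have "((\<lambda>t. complex_of_real (ramp (Suc (Suc j)) (t - r y))) has_vector_derivative of_real (ramp (Suc j) (t - r y))) (at t)"
      by (intro has_vector_derivative_of_real) (simp add: has_real_derivative_iff_has_vector_derivative)
    then show "((\<lambda>t. c y * of_real (ramp (Suc (Suc j)) (t - r y))) has_vector_derivative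
        c y * of_real (ramp (Suc j) (t - r y))) (at t within UNIV)"
      by (intro has_vector_derivative_mult_right)
  next
    show "continuous_on (UNIV \<times> cbox lo hi) (\<lambda>(t, y). c y * of_real (ramp (Suc j) (t - r y)))"
      unfolding split_beta by (intro continuous_intros) auto
  qed (auto intro!: integrable_continuous continuous_intros)
  then show ?thesis by simp
qed

text \<open>
  The operator \<open>a + b \<sigma>\<close>, with \<open>\<sigma>\<close> the shift of the index of \<open>T\<close>, is applied to \<open>(a + b \<sigma>)\<^sup>n T\<close>. It describes one
  differentiation of \<open>exp(t a) \<rho>(r + t b)\<close> with respect to \<open>t\<close>.
\<close>
lemma binomial_shift:
  fixes a b :: "'a::comm_ring_1"
  shows "(\<Sum>i\<le>n. of_nat (n choose i) * a ^ (n - i) * b ^ i * (a * T i + b * T (Suc i)))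
    = (\<Sum>i\<le>Suc n. of_nat (Suc n choose i) * a ^ (Suc n - i) * b ^ i * T i)"
proof -
  let ?F = "\<lambda>i. of_nat (n choose i) * a ^ (Suc n - i) * b ^ i * T i"
  have "(\<Sum>i\<le>n. of_nat (n choose i) * a ^ (n - i) * b ^ i * (a * T i)) = (\<Sum>i\<le>n. ?F i)"
    by (intro sum.cong refl) (simp add: Suc_diff_le mult_ac)
  also have "\<dots> = (\<Sum>i\<le>Suc n. ?F i)" by (simp add: binomial_eq_0)
  also have "\<dots> = ?F 0 + (\<Sum>i\<le>n. ?F (Suc i))" by (rule sum.atMost_Suc_shift)
  finally have 1: "(\<Sum>i\<le>n. of_nat (n choose i) * a ^ (n - i) * b ^ i * (a * T i)) = ?F 0 + (\<Sum>i\<le>n. ?F (Suc i))" .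
  show ?thesis
    unfolding sum.atMost_Suc_shift[of _ n] distrib_left sum.distrib 1
    by (simp add: algebra_simps sum.distrib)
qed

text \<open>
  The derivative of order \<open>N\<close> at \<open>t = 0\<close> of an integral that vanishes for small \<open>t\<close>. The exponent \<open>N + 1\<close> of the
  truncated power drops to 1 after \<open>N\<close> differentiations, so that all integrands stay continuous.
\<close>
lemma iterated_derivative_zero:
  fixes f A :: "'a::euclidean_space \<Rightarrow> complex" and B r :: "'a \<Rightarrow> real"
  assumes f: "continuous_on (cbox lo hi) f" and A: "continuous_on (cbox lo hi) A"
    and B: "continuous_on (cbox lo hi) B" and r: "continuous_on (cbox lo hi) r" and "d > 0"
    and zero: "\<And>t. \<bar>t\<bar> < d \<Longrightarrow>
      integral (cbox lo hi) (\<lambda>y. f y * (exp (of_real t * A y) * of_real (ramp (Suc N) (r y + t * B y)))) = 0"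
  shows "integral (cbox lo hi) (\<lambda>y. f y * (\<Sum>b\<le>N. of_nat (N choose b) * A y ^ (N - b) * of_real (B y) ^ b
    * of_real (ramp (Suc N - b) (r y)))) = 0"
proof -
  note cont [continuous_intros] = f A B r
  note [continuous_intros] = cont[THEN continuous_on_compose2, where f=snd]
  define T where "T b t y = exp (of_real t * A y) * of_real (ramp (Suc N - b) (r y + t * B y))" for b t y
  define D where "D n t y = f y * (\<Sum>b\<le>n. of_nat (n choose b) * A y ^ (n - b) * of_real (B y) ^ b * T b t y)" for n t y
  have T: "((\<lambda>t. T b t y) has_vector_derivative A y * T b t y + of_real (B y) * T (Suc b) t y) (at t within X)"
    if b: "b < N" for b y t X
  proof -
    obtain j where j: "Suc N - b = Suc (Suc j)" using b by (metis Suc_diff_Suc Suc_diff_le less_imp_le)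
    then have j': "Suc N - Suc b = Suc j" by simp
    have "((\<lambda>z. exp (z * A y)) has_field_derivative A y * exp (of_real t * A y)) (at (of_real t))"
      by (rule derivative_eq_intros refl | simp)+
    then have e: "((\<lambda>t. exp (of_real t * A y)) has_vector_derivative A y * exp (of_real t * A y)) (at t within X)"
      by (rule has_vector_derivative_real_field)
    have "((\<lambda>t. ramp (Suc (Suc j)) (r y + t * B y)) has_real_derivative ramp (Suc j) (r y + t * B y) * B y) (at t within X)"
      by (rule DERIV_chain2[OF ramp_derivative]) (auto intro!: derivative_eq_intros)
    then have "((\<lambda>t. complex_of_real (ramp (Suc (Suc j)) (r y + t * B y))) has_vector_derivative
        of_real (ramp (Suc j) (r y + t * B y) * B y)) (at t within X)"
      by (intro has_vector_derivative_of_real) (simp add: has_real_derivative_iff_has_vector_derivative)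
    from has_vector_derivative_mult[OF e this] show ?thesis
      unfolding T_def j j' by (simp add: algebra_simps)
  qed
  have "integral (cbox lo hi) (D n t) = 0" if "n \<le> N" "\<bar>t\<bar> < d" for n t
    using that
  proof (induction n arbitrary: t)
    case 0
    then show ?case using zero by (simp add: D_def T_def)
  next
    case (Suc n)
    have n: "n < N" using Suc.prems by simp
    let ?U = "{-d<..<d}"
    have t: "t \<in> ?U" using Suc.prems by auto
    have "((\<lambda>t. integral (cbox lo hi) (D n t)) has_vector_derivative integral (cbox lo hi) (D (Suc n) t)) (at t within ?U)"
    proof (rule leibniz_rule_vector_derivative)
      fix t y
      have "((\<lambda>t. D n t y) has_vector_derivative f y * (\<Sum>b\<le>n. of_nat (n choose b) * A y ^ (n - b) * of_real (B y) ^ b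
        * (A y * T b t y + of_real (B y) * T (Suc b) t y))) (at t within ?U)"
        unfolding D_def using n
        by (intro has_vector_derivative_mult_right has_vector_derivative_sum T) auto
      then show "((\<lambda>t. D n t y) has_vector_derivative D (Suc n) t y) (at t within ?U)"
        unfolding binomial_shift[where T="\<lambda>b. T b t y"] by (simp only: D_def)
    next
      show "continuous_on (?U \<times> cbox lo hi) (\<lambda>(t, y). D (Suc n) t y)"
        unfolding D_def T_def split_beta by (intro continuous_intros) auto
      show "D n t integrable_on cbox lo hi" for t
        unfolding D_def T_def by (intro integrable_continuous continuous_intros)
    qed (use t in auto)
    moreover have "((\<lambda>t. integral (cbox lo hi) (D n t)) has_vector_derivative 0) (at t within ?U)"
    proof (rule has_vector_derivative_transform[of _ _ _ "\<lambda>_. 0"])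
      show "integral (cbox lo hi) (D n s) = 0" if "s \<in> ?U" for s
        using that Suc.prems by (intro Suc.IH) auto
    qed (use t in auto)
    ultimately show ?case
      using t by (auto dest!: vector_derivative_at simp: at_within_open[OF t open_greaterThanLessThan])
  qed
  from this[of N 0] \<open>d > 0\<close> show ?thesis by (simp add: D_def[abs_def] T_def)
qed

text \<open>
  The substitution \<open>y = z - w\<close> changes the phase only by the factor \<open>exp(i \<phi>(z) / 2)\<close>, which does not depend on \<open>y\<close>,
  and the truncated power is constant on the spheres around \<open>z\<close>.
\<close>
lemma twisted_ramp_integral_zero:
  fixes f :: "'a::euclidean_space \<Rightarrow> complex" and ph :: "'a \<Rightarrow> real"
  assumes f: "continuous_on UNIV f" and ph: "linear ph" and M: "0 < M"
    and means: "\<And>s. 0 < s \<Longrightarrow> (\<integral>w. f (z - w) * exp (\<i> / 2 * of_real (ph w)) \<partial>sphere_measure s) = 0"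
    and Q: "\<And>y. (norm (z - y))\<^sup>2 < S \<Longrightarrow> y \<in> cbox lo hi"
  shows "integral (cbox lo hi) (\<lambda>y. f y * (exp (- (\<i> / 2 * of_real (ph y))) * of_real (ramp M (S - (norm (z - y))\<^sup>2)))) = 0"
proof -
  have phc: "continuous_on UNIV ph" using ph by (simp add: linear_continuous_on linear_conv_bounded_linear)
  note [continuous_intros] = continuous_on_compose2[OF f] continuous_on_compose2[OF phc]
  define h where "h w = f (z - w) * exp (\<i> / 2 * of_real (ph w))" for w
  define H where "H w = h w * of_real (ramp M (S - (norm w)\<^sup>2))" for w
  define F where "F y = f y * (exp (- (\<i> / 2 * of_real (ph y))) * of_real (ramp M (S - (norm (z - y))\<^sup>2)))" for y
  have hc: "continuous_on UNIV h" unfolding h_def by (intro continuous_intros) auto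
  have Hc: "continuous_on UNIV H" unfolding H_def by (intro continuous_intros hc)
  have Fc: "continuous_on UNIV F" unfolding F_def by (intro continuous_intros) auto
  note meas = borel_measurable_continuous_onI
  have H0: "(\<integral>w. H w \<partial>lborel) = 0"
  proof (rule integral_eq_0_if_sphere_means_0[OF Hc])
    (* Beyond this radius the squared norm exceeds S. *)
    show "0 < \<bar>S\<bar> + 1" by simp
    show "H w = 0" if "norm w > \<bar>S\<bar> + 1" for w
    proof -
      have "norm w \<le> (norm w)\<^sup>2" using that self_le_power[of "norm w" 2] by simp
      then have "S - (norm w)\<^sup>2 \<le> 0" using that by linarith
      then show ?thesis using M by (simp add: H_def ramp_nonpos)
    qed
    fix s :: real assume s: "0 < s"
    have [measurable]: "H \<in> borel_measurable borel" "h \<in> borel_measurable borel"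
      using Hc hc by (auto intro: meas)
    have "(\<integral>w. indicator (cball 0 1) w *\<^sub>R H ((s / norm w) *\<^sub>R w) \<partial>lborel)
      = (\<integral>w. (indicator (cball 0 1) w *\<^sub>R h ((s / norm w) *\<^sub>R w)) * of_real (ramp M (S - s\<^sup>2)) \<partial>lborel)"
    proof (rule integral_cong_AE)
      show "AE w in lborel. indicator (cball 0 1) w *\<^sub>R H ((s / norm w) *\<^sub>R w)
        = (indicator (cball 0 1) w *\<^sub>R h ((s / norm w) *\<^sub>R w)) * of_real (ramp M (S - s\<^sup>2))"
        using AE_lborel_singleton[of "0::'a"] by eventually_elim (use s in \<open>simp add: H_def\<close>)
      have [measurable]: "cball (0::'a) 1 \<in> sets borel" by simp
      show "(\<lambda>w. indicator (cball 0 1) w *\<^sub>R H ((s / norm w) *\<^sub>R w)) \<in> borel_measurable lborel"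
        and "(\<lambda>w. (indicator (cball 0 1) w *\<^sub>R h ((s / norm w) *\<^sub>R w)) * of_real (ramp M (S - s\<^sup>2))) \<in> borel_measurable lborel"
        by measurable
    qed
    also have "\<dots> = (\<integral>w. indicator (cball 0 1) w *\<^sub>R h ((s / norm w) *\<^sub>R w) \<partial>lborel) * of_real (ramp M (S - s\<^sup>2))"
      by (rule Bochner_Integration.integral_mult_left_zero)
    also have "(\<integral>w. indicator (cball 0 1) w *\<^sub>R h ((s / norm w) *\<^sub>R w) \<partial>lborel) = 0"
    proof -
      have "(\<integral>w. h w \<partial>sphere_measure s) = 0" unfolding h_def by (rule means[OF s])
      then show ?thesis
        using sphere_mean_eq_ball_integral[of h s] content_cball_pos[of 1 "0::'a"] by simp
    qed
    finally show "(\<integral>w. H w \<partial>sphere_measure s) = 0"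
      by (simp add: sphere_mean_eq_ball_integral)
  qed
  have "(\<integral>y. F y \<partial>lborel) = (\<integral>y. F y \<partial>density (distr lborel borel (\<lambda>w. z + (-1) *\<^sub>R w)) (\<lambda>_. \<bar>-1::real\<bar> ^ DIM('a)))"
    by (subst lborel_affine[of "-1" z]) auto
  also have "\<dots> = (\<integral>w. F (z - w) \<partial>lborel)"
    using meas[OF Fc] by (simp add: density_1 integral_distr)
  also have "\<dots> = (\<integral>w. exp (- (\<i> / 2 * of_real (ph z))) * H w \<partial>lborel)"
    by (intro arg_cong[where f="integral\<^sup>L lborel"] ext)
      (simp add: F_def H_def h_def linear_diff[OF ph] algebra_simps flip: exp_add)
  also have "\<dots> = 0" using H0 by simp
  finally have "(\<integral>y. F y \<partial>lborel) = 0" .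
  moreover have "F y = 0" if "y \<notin> cbox lo hi" for y
  proof -
    have "S - (norm (z - y))\<^sup>2 \<le> 0" using Q[of y] that by linarith
    then show ?thesis using M by (simp add: F_def ramp_nonpos)
  qed
  then have "(\<integral>y. F y \<partial>lborel) = (LINT y : cbox lo hi | lborel. F y)"
    unfolding set_lebesgue_integral_def
    by (intro arg_cong[where f="integral\<^sup>L lborel"] ext)
      (auto simp: indicator_def)
  moreover have "set_integrable lborel (cbox lo hi) F"
    unfolding set_integrable_def by (intro borel_integrable_compact continuous_on_subset[OF Fc]) auto
  ultimately have "integral (cbox lo hi) F = 0"
    using set_borel_integral_eq_integral(2)[of "cbox lo hi" F] by simp
  then show ?thesis unfolding F_def[abs_def] .
qed

section \<open>Vanishing of all moments\<close>

text \<open>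
  Multiplication by \<open>\<bar>y\<bar>\<^sup>2\<close> stays in the span of the radial weights in use, since \<open>\<bar>y\<bar>\<^sup>2 = S - (S - \<bar>y\<bar>\<^sup>2)\<close>.
\<close>
lemma inner_times_ramp:
  "(y \<bullet> y) * ramp (Suc j) (S - y \<bullet> y) = S * ramp (Suc j) (S - y \<bullet> y) - of_nat (j + 2) * ramp (Suc (Suc j)) (S - y \<bullet> y)"
proof -
  have "(y \<bullet> y) * ramp (Suc j) (S - y \<bullet> y) = S * ramp (Suc j) (S - y \<bullet> y) - (S - y \<bullet> y) * ramp (Suc j) (S - y \<bullet> y)"
    by (simp add: algebra_simps)
  then show ?thesis by (simp add: mult_ramp)
qed

text \<open>
  The heart of the proof, by induction on the degree \<open>N\<close>. The form \<open>A k\<close> stands for \<open>- i \<omega>(k, \<cdot>) / 2\<close>. Only the term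
  \<open>b = N\<close> of the hypothesis carries the weight with the lowest exponent; all others are primitives of
  higher order in \<open>S\<close>. Hence the hypothesis bounds the moments with the lowest exponent by those with higher
  exponents, and these have the former as derivatives.
\<close>
lemma ramp_moments_zero:
  fixes f :: "complex ^ 'n::finite \<Rightarrow> complex" and A :: "complex ^ 'n \<Rightarrow> complex ^ 'n \<Rightarrow> complex" and N :: nat
  assumes cone: "is_complex_cone K" and nh: "non_harmonic K"
    and f: "continuous_on (cbox lo hi) f" and A: "\<And>k. linear (A k)"
    and rel: "\<And>N S k. k \<in> K \<Longrightarrow> S < R \<Longrightarrow>
      integral (cbox lo hi) (\<lambda>y. f y * (\<Sum>b\<le>N. of_nat (N choose b) * A k y ^ (N - b)
        * of_real (2 * (k \<bullet> y)) ^ b * of_real (ramp (Suc N - b) (S - y \<bullet> y)))) = 0"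
    and S: "S < R"
  shows "integral (cbox lo hi) (\<lambda>y. f y * of_real (ramp (Suc j) (S - y \<bullet> y)) * (\<Prod>i<N. of_real (x i \<bullet> y))) = 0"
  using S
proof (induction N arbitrary: j S x rule: less_induct)
  case (less N)
  let ?Q = "cbox lo hi"
  have Ac: "continuous_on X (A k)" for X k
    using A by (simp add: linear_continuous_on linear_conv_bounded_linear)
  note [continuous_intros] = f Ac
  (* L carries the weight ramp (Suc j), so that the lowest exponent 1 corresponds to j = 0. *)
  define L where "L j S c = integral ?Q (\<lambda>y. f y * of_real (ramp (Suc j) (S - y \<bullet> y)) * (\<Prod>i<N. c i y))"
    for j S and c :: "nat \<Rightarrow> complex ^ 'n \<Rightarrow> complex"
  (* Points of interpolation: sequences of linear factors; the diagonal ones come from powers of the inner product. *)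
  define X where "X = {c :: nat \<Rightarrow> complex ^ 'n \<Rightarrow> complex. \<forall>i. linear (c i)}"
  define diag :: "complex ^ 'n \<Rightarrow> nat \<Rightarrow> complex ^ 'n \<Rightarrow> complex" where "diag k i y = of_real (k \<bullet> y)" for k i y
  (* The condition on g makes its moments of degree N harmonic polynomials; it is linear in g, so H is a space. *)
  define H where "H = {h. \<exists>g. continuous_on ?Q g \<and> (\<forall>x. 2 \<le> N \<longrightarrow>
      integral ?Q (\<lambda>y. g y * of_real (y \<bullet> y) * (\<Prod>i<N - 2. of_real (x i \<bullet> y))) = 0) \<and>
      h = (\<lambda>c. if c \<in> X then integral ?Q (\<lambda>y. g y * (\<Prod>i<N. c i y)) else 0)}"
  have Xc: "continuous_on ?Q (c i)" if "c \<in> X" for c i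
    using that by (simp add: X_def linear_continuous_on linear_conv_bounded_linear)
  have diagX: "diag k \<in> X" for k
    by (auto simp: X_def diag_def linear_iff inner_simps scaleR_conv_of_real[where 'a=complex])
  have "\<exists>K0 w. finite K0 \<and> K0 \<subseteq> diag ` K \<and> (\<forall>h\<in>H. \<forall>x\<in>X. h x = (\<Sum>k\<in>K0. w x k * h k))"
  proof (rule finite_interpolation[where I="PiE {..<N} (\<lambda>_. Basis)" and b="\<lambda>J c. \<Prod>i<N. c i (J i)"])
    show "finite (PiE {..<N} (\<lambda>_. Basis :: (complex ^ 'n) set))" by (intro finite_PiE) auto
    show "diag ` K \<subseteq> X" using diagX by blast
  next
    fix h h' :: "(nat \<Rightarrow> complex ^ 'n \<Rightarrow> complex) \<Rightarrow> complex" and a :: complex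
    assume "h \<in> H" "h' \<in> H"
    then obtain g g' where g: "continuous_on ?Q g" "continuous_on ?Q g'"
      and gl: "\<And>x. 2 \<le> N \<Longrightarrow> integral ?Q (\<lambda>y. g y * of_real (y \<bullet> y) * (\<Prod>i<N - 2. of_real (x i \<bullet> y))) = 0"
        "\<And>x. 2 \<le> N \<Longrightarrow> integral ?Q (\<lambda>y. g' y * of_real (y \<bullet> y) * (\<Prod>i<N - 2. of_real (x i \<bullet> y))) = 0"
      and h: "h = (\<lambda>c. if c \<in> X then integral ?Q (\<lambda>y. g y * (\<Prod>i<N. c i y)) else 0)"
        "h' = (\<lambda>c. if c \<in> X then integral ?Q (\<lambda>y. g' y * (\<Prod>i<N. c i y)) else 0)"
      unfolding H_def by blast
    note [continuous_intros] = g
    have lin: "integral ?Q (\<lambda>y. (g y - a * g' y) * p y) = integral ?Q (\<lambda>y. g y * p y) - a * integral ?Q (\<lambda>y. g' y * p y)"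
      if [continuous_intros]: "continuous_on ?Q p" for p
    proof -
      have "integral ?Q (\<lambda>y. (g y - a * g' y) * p y) = integral ?Q (\<lambda>y. g y * p y - a * (g' y * p y))"
        by (simp add: algebra_simps)
      also have "\<dots> = integral ?Q (\<lambda>y. g y * p y) - integral ?Q (\<lambda>y. a * (g' y * p y))"
        by (intro Henstock_Kurzweil_Integration.integral_diff integrable_continuous continuous_intros)
      finally show ?thesis by simp
    qed
    have "integral ?Q (\<lambda>y. (g y - a * g' y) * of_real (y \<bullet> y) * (\<Prod>i<N - 2. of_real (x i \<bullet> y))) = 0"
      if "2 \<le> N" for x
      using lin[of "\<lambda>y. of_real (y \<bullet> y) * (\<Prod>i<N - 2. of_real (x i \<bullet> y))"] gl[OF that, of x]
      by (simp add: mult.assoc continuous_intros)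
    moreover have "(\<lambda>c. h c - a * h' c) = (\<lambda>c. if c \<in> X then integral ?Q (\<lambda>y. (g y - a * g' y) * (\<Prod>i<N. c i y)) else 0)"
      using lin Xc by (auto simp: h fun_eq_iff continuous_intros)
    ultimately show "(\<lambda>c. h c - a * h' c) \<in> H"
      unfolding H_def mem_Collect_eq
      by (intro exI[of _ "\<lambda>y. g y - a * g' y"]) (auto intro!: continuous_intros)
  next
    fix h assume "h \<in> H"
    then obtain g where g: "continuous_on ?Q g"
      and h: "\<And>c. c \<in> X \<Longrightarrow> h c = integral ?Q (\<lambda>y. g y * (\<Prod>i<N. c i y))"
      unfolding H_def by auto
    show "\<exists>c. \<forall>x\<in>X. h x = (\<Sum>J\<in>PiE {..<N} (\<lambda>_. Basis). c J * (\<Prod>i<N. x i (J i)))"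
      by (intro exI[of _ "\<lambda>J. integral ?Q (\<lambda>y. g y * (\<Prod>i<N. of_real (J i \<bullet> y)))"] ballI)
        (simp add: h moment_expansion[OF g] X_def)
  next
    fix h assume "h \<in> H" and zero: "\<forall>k\<in>diag ` K. h k = 0"
    then obtain g where g: "continuous_on ?Q g"
      and gl: "\<And>x. 2 \<le> N \<Longrightarrow> integral ?Q (\<lambda>y. g y * of_real (y \<bullet> y) * (\<Prod>i<N - 2. of_real (x i \<bullet> y))) = 0"
      and h: "\<And>c. c \<in> X \<Longrightarrow> h c = integral ?Q (\<lambda>y. g y * (\<Prod>i<N. c i y))"
      unfolding H_def by auto
    have kz: "integral ?Q (\<lambda>y. g y * of_real (k \<bullet> y) ^ N) = 0" if "k \<in> K" for k
      using zero that h[OF diagX, of k] by (simp add: diag_def)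
    have "integral ?Q (\<lambda>y. g y * of_real (x \<bullet> y) ^ N) = 0" for x
      by (rule moment_zero_if_zero_on_cone[OF cone nh g]) (fact gl kz)+
    then have "integral ?Q (\<lambda>y. g y * (\<Prod>i<N. of_real (x i \<bullet> y))) = 0" for x
      by (rule polarization[OF g])
    then show "\<forall>x\<in>X. h x = 0"
      using moment_complex_linear[OF g] by (auto simp: h X_def)
  qed
  then obtain K0 w where K0: "finite K0" "K0 \<subseteq> diag ` K"
    and w: "\<And>h c. h \<in> H \<Longrightarrow> c \<in> X \<Longrightarrow> h c = (\<Sum>k\<in>K0. w c k * h k)" by blast
  have K0X: "d \<in> X" if "d \<in> K0" for d using that K0(2) diagX by blast
  have L_interp: "L j S c = (\<Sum>d\<in>K0. w c d * L j S d)" if S: "S < R" and c: "c \<in> X" for j S c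
  proof -
    let ?g = "\<lambda>y. f y * of_real (ramp (Suc j) (S - y \<bullet> y))"
    let ?P = "\<lambda>x y. \<Prod>i<N - 2. complex_of_real (x i \<bullet> y)"
    have gc: "continuous_on ?Q ?g" by (intro continuous_intros)
    have "integral ?Q (\<lambda>y. ?g y * of_real (y \<bullet> y) * ?P x y) = 0" if "2 \<le> N" for x
    proof -
      have "?g y * of_real (y \<bullet> y) * ?P x y = of_real S * (?g y * ?P x y)
        - of_nat (j + 2) * (f y * of_real (ramp (Suc (Suc j)) (S - y \<bullet> y)) * ?P x y)" for y
      proof -
        have "?g y * of_real (y \<bullet> y) * ?P x y = f y * of_real ((y \<bullet> y) * ramp (Suc j) (S - y \<bullet> y)) * ?P x y"
          by simp
        then show ?thesis unfolding inner_times_ramp by (simp add: algebra_simps)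
      qed
      then have "integral ?Q (\<lambda>y. ?g y * of_real (y \<bullet> y) * ?P x y) =
        integral ?Q (\<lambda>y. of_real S * (?g y * ?P x y))
        - integral ?Q (\<lambda>y. of_nat (j + 2) * (f y * of_real (ramp (Suc (Suc j)) (S - y \<bullet> y)) * ?P x y))"
        by (simp only:) (intro Henstock_Kurzweil_Integration.integral_diff integrable_continuous continuous_intros)
      moreover have "N - 2 < N" using that by simp
      ultimately show ?thesis
        using less.IH[of "N - 2" S j x] less.IH[of "N - 2" S "Suc j" x] S by simp
    qed
    then have "(\<lambda>c. if c \<in> X then integral ?Q (\<lambda>y. ?g y * (\<Prod>i<N. c i y)) else 0) \<in> H"
      using gc unfolding H_def by blast
    from w[OF this c] show ?thesis
      using c K0X by (simp add: L_def cong: sum.cong)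
  qed
  define kk where "kk d = (SOME k. k \<in> K \<and> d = diag k)" for d
  have kk: "kk d \<in> K" "d = diag (kk d)" if "d \<in> K0" for d
    using someI_ex[of "\<lambda>k. k \<in> K \<and> d = diag k"] that K0(2) unfolding kk_def by blast+
  (* The linear factors of the term b in the hypothesis: N - b of them come from the twist. *)
  define cc where "cc d b i = (if i < N - b then A (kk d) else (\<lambda>y. of_real (kk d \<bullet> y)))" for d b i
  have ccX: "cc d b \<in> X" for d b
    using A by (auto simp: X_def cc_def linear_iff inner_simps scaleR_conv_of_real[where 'a=complex])
  have L_rel: "L 0 s d * 2 ^ N = - (\<Sum>b<N. of_nat (N choose b) * 2 ^ b * L (N - b) s (cc d b))"
    if d: "d \<in> K0" and s: "s < R" for d s
  proof -
    have "0 = integral ?Q (\<lambda>y. f y * (\<Sum>b\<le>N. of_nat (N choose b) * A (kk d) y ^ (N - b)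
        * of_real (2 * (kk d \<bullet> y)) ^ b * of_real (ramp (Suc N - b) (s - y \<bullet> y))))"
      using rel[OF kk(1)[OF d] s] by simp
    also have "\<dots> = integral ?Q (\<lambda>y. \<Sum>b\<le>N. of_nat (N choose b) * 2 ^ b *
        (f y * of_real (ramp (Suc (N - b)) (s - y \<bullet> y)) * (\<Prod>i<N. cc d b i y)))"
    proof -
      have "(\<Prod>i<N. cc d b i y) = A (kk d) y ^ (N - b) * of_real (kk d \<bullet> y) ^ b" if "b \<le> N" for b y
        using prod_two_factors[where m="N - b" and n=b and a="A (kk d) y" and b="of_real (kk d \<bullet> y)"] that
        by (simp add: cc_def if_distribR)
      then show ?thesis
        unfolding sum_distrib_left
        by (intro arg_cong[where f="integral ?Q"] ext sum.cong refl)
          (simp add: Suc_diff_le power_mult_distrib mult_ac)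
    qed
    also have "\<dots> = (\<Sum>b\<le>N. of_nat (N choose b) * 2 ^ b * L (N - b) s (cc d b))"
      unfolding L_def using Xc[OF ccX]
      by (subst integral_sum) (auto intro!: integrable_continuous continuous_intros)
    also have "\<dots> = (\<Sum>b<N. of_nat (N choose b) * 2 ^ b * L (N - b) s (cc d b)) + 2 ^ N * L 0 s (cc d N)"
      by (simp add: lessThan_Suc_atMost[symmetric])
    also have "cc d N = d" by (subst kk(2)[OF d]) (simp add: cc_def diag_def fun_eq_iff)
    finally show ?thesis unfolding mult.commute[of "L 0 s d"] by (intro add.inverse_unique[symmetric]) simp
  qed
  (* Unknowns of the differential system: all but the lowest exponent, which the relation expresses by the others. *)
  define I where "I = {1..N} \<times> K0"
  define Z where "Z s = (\<Sum>(j, d)\<in>I. norm (L j s d))" for s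
  (* The summand 1 covers the equations in which the derivative of an unknown is another unknown. *)
  define C where "C = 1 + (\<Sum>d\<in>K0. \<Sum>b<N. of_nat (N choose b) * 2 ^ b * (\<Sum>e\<in>K0. norm (w (cc d b) e)))"
  have finI: "finite I" using K0 by (simp add: I_def)
  have Z_ge: "norm (L j s d) \<le> Z s" if "(j, d) \<in> I" for j s d
    unfolding Z_def using member_le_sum[OF that, of "\<lambda>(j, d). norm (L j s d)"] finI by auto
  have Z0: "0 \<le> Z s" for s unfolding Z_def by (intro sum_nonneg) auto
  have C1: "C \<ge> 1" unfolding C_def by (simp add: sum_nonneg)
  have L0_bound: "norm (L 0 s d) \<le> C * Z s" if d: "d \<in> K0" and s: "s < R" for d s
  proof -
    have "norm (L 0 s d) \<le> norm (L 0 s d) * 2 ^ N" using mult_left_mono[of 1 "2 ^ N" "norm (L 0 s d)"] by simp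
    also have "\<dots> = norm (\<Sum>b<N. of_nat (N choose b) * 2 ^ b * L (N - b) s (cc d b))"
      using arg_cong[OF L_rel[OF d s], of norm] by (simp add: norm_mult norm_power)
    also have "\<dots> \<le> (\<Sum>b<N. of_nat (N choose b) * 2 ^ b * ((\<Sum>e\<in>K0. norm (w (cc d b) e)) * Z s))"
    proof (intro sum_norm_le)
      fix b assume b: "b \<in> {..<N}"
      have "norm (L (N - b) s (cc d b)) \<le> (\<Sum>e\<in>K0. norm (w (cc d b) e) * Z s)"
        unfolding L_interp[OF s ccX]
        by (intro sum_norm_le) (use b in \<open>auto simp: norm_mult I_def intro!: mult_left_mono Z_ge\<close>)
      then show "norm (of_nat (N choose b) * 2 ^ b * L (N - b) s (cc d b))
        \<le> of_nat (N choose b) * 2 ^ b * ((\<Sum>e\<in>K0. norm (w (cc d b) e)) * Z s)"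
        by (simp add: norm_mult norm_power sum_distrib_right mult_left_mono)
    qed
    also have "\<dots> = (\<Sum>b<N. of_nat (N choose b) * 2 ^ b * (\<Sum>e\<in>K0. norm (w (cc d b) e))) * Z s"
      by (simp add: sum_distrib_right mult.assoc)
    also have "\<dots> \<le> C * Z s"
    proof (intro mult_right_mono Z0)
      have "(\<Sum>b<N. of_nat (N choose b) * 2 ^ b * (\<Sum>e\<in>K0. norm (w (cc d b) e)))
        \<le> (\<Sum>d\<in>K0. \<Sum>b<N. of_nat (N choose b) * 2 ^ b * (\<Sum>e\<in>K0. norm (w (cc d b) e)))"
        using d K0(1) by (intro member_le_sum[of d K0]) (auto intro!: sum_nonneg mult_nonneg_nonneg)
      then show "(\<Sum>b<N. of_nat (N choose b) * 2 ^ b * (\<Sum>e\<in>K0. norm (w (cc d b) e))) \<le> C"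
        by (simp add: C_def)
    qed
    finally show ?thesis .
  qed
  have L_deriv: "((\<lambda>s. L (Suc j) s d) has_vector_derivative L j s d) (at s)" if "d \<in> K0" for j s d
  proof -
    have "continuous_on ?Q (\<lambda>y. f y * (\<Prod>i<N. d i y))"
      by (intro continuous_intros Xc K0X that)
    from ramp_integral_derivative[OF this, of "\<lambda>y. y \<bullet> y" j s] show ?thesis
      by (simp add: L_def mult_ac continuous_intros)
  qed
  have L_nonpos: "L j s d = 0" if "s \<le> 0" for j s d
    unfolding L_def using that
    by (simp add: ramp_nonpos order_trans[OF that inner_ge_zero])
  have L0: "L 0 S d = 0" if d: "d \<in> K0" and S: "S < R" for d S
  proof (cases "0 \<le> S")
    case True
    have "L j S e = 0" if "(j, e) \<in> I" for j e
    proof -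
      have "(\<lambda>(j, e) s. L j s e) (j, e) S = 0"
      proof (rule linear_system_zero[OF finI True, where z="\<lambda>(j, e) s. L j s e" and z'="\<lambda>(j, e) s. L (j - 1) s e" and C=C])
        fix i :: "nat \<times> (nat \<Rightarrow> complex ^ 'n \<Rightarrow> complex)" and s assume i: "i \<in> I" "0 \<le> s" "s \<le> S"
        obtain j e where je: "i = (Suc j, e)" "e \<in> K0" using i(1) by (cases i, cases "fst i") (auto simp: I_def)
        show "((case i of (j, e) \<Rightarrow> \<lambda>s. L j s e) has_vector_derivative (case i of (j, e) \<Rightarrow> \<lambda>s. L (j - 1) s e) s) (at s)"
          using L_deriv je by simp
        have "norm (L j s e) \<le> C * Z s"
        proof (cases j)
          case 0
          then show ?thesis using L0_bound je i S by simp
        next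
          case (Suc j')
          then have "norm (L j s e) \<le> 1 * Z s" using i je by (simp, intro Z_ge) (auto simp: I_def)
          also have "\<dots> \<le> C * Z s" using C1 Z0 by (intro mult_right_mono)
          finally show ?thesis .
        qed
        then show "norm ((case i of (j, e) \<Rightarrow> \<lambda>s. L (j - 1) s e) s) \<le> C * (\<Sum>i\<in>I. norm ((case i of (j, e) \<Rightarrow> \<lambda>s. L j s e) s))"
          using je by (simp add: Z_def split_beta)
      qed (use that L_nonpos in auto)
      then show ?thesis by simp
    qed
    then have "Z S = 0" unfolding Z_def by (intro sum.neutral) auto
    with L0_bound[OF d S] show ?thesis by simp
  qed (simp add: L_nonpos)
  (* The higher exponents follow by integration from S = 0. *)
  have Lj: "L j S d = 0" if d: "d \<in> K0" and S: "S < R" for d S j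
    using S
  proof (induction j arbitrary: S)
    case (Suc j)
    show ?case
    proof (cases "0 \<le> S")
      case True
      show ?thesis
      proof (rule linear_system_zero[OF _ True, where I="{()}" and z="\<lambda>_ s. L (Suc j) s d" and z'="\<lambda>_ s. L j s d" and C=0])
        show "((\<lambda>s. L (Suc j) s d) has_vector_derivative L j s d) (at s)" for s
          by (rule L_deriv[OF d])
      qed (use Suc in \<open>auto simp: L_nonpos\<close>)
    qed (simp add: L_nonpos)
  qed (rule L0[OF d])
  have "(\<lambda>i y. complex_of_real (x i \<bullet> y)) \<in> X"
    by (auto simp: X_def linear_iff inner_simps scaleR_conv_of_real[where 'a=complex])
  from L_interp[OF less.prems this, of j] Lj less.prems show ?case
    by (simp add: L_def)
qed

text \<open>
  The moments are taken over a box that contains a large ball. Moving the centre of the spheres from \<open>0\<close> to \<open>t k\<close>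
  for small \<open>t\<close> keeps the support of the truncated power inside the box.
\<close>
lemma zero_if_twisted_means_zero:
  fixes f :: "complex ^ 'n::finite \<Rightarrow> complex" and om :: "complex ^ 'n \<Rightarrow> complex ^ 'n \<Rightarrow> real"
  assumes cone: "is_complex_cone K" and nh: "non_harmonic K" and f: "continuous_on UNIV f"
    and om: "\<And>z. linear (om z)" and om_scale: "\<And>t z w. om (t *\<^sub>R z) w = t * om z w"
    and means: "\<And>s z. 0 < s \<Longrightarrow> z \<in> K \<Longrightarrow>
      (\<integral>w. f (z - w) * exp (\<i> / 2 * of_real (om z w)) \<partial>sphere_measure s) = 0"
  shows "f = (\<lambda>_. 0)"
proof
  fix y0 :: "complex ^ 'n"
  (* The box contains the ball of radius R + 1; the unit of margin allows for the displacement of the centre. *)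
  define R where "R = norm y0 + 1"
  have R: "R \<ge> 1" by (simp add: R_def)
  obtain a where a: "cball (0 :: complex ^ 'n) (R + 1) \<subseteq> cbox (- a) a"
    using bounded_subset_cbox_symmetric[OF bounded_cball] by blast
  let ?Q = "cbox (- a) a"
  define A where "A k y = - (\<i> / 2 * of_real (om k y))" for k y
  have Alin: "linear (A k)" for k
    by (rule linearI) (simp_all add: A_def linear_add[OF om] linear_scale[OF om] algebra_simps scaleR_conv_of_real[where 'a=complex])
  have fQ: "continuous_on ?Q f" using f by (rule continuous_on_subset) simp
  have rel: "integral ?Q (\<lambda>y. f y * (\<Sum>b\<le>N. of_nat (N choose b) * A k y ^ (N - b)
        * of_real (2 * (k \<bullet> y)) ^ b * of_real (ramp (Suc N - b) (S - y \<bullet> y)))) = 0"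
    if k: "k \<in> K" and S: "S < R\<^sup>2" for N S k
  proof (rule iterated_derivative_zero[OF fQ, where d="1 / (2 * (norm k + 1))"])
    show "continuous_on ?Q (A k)"
      using Alin by (simp add: linear_continuous_on linear_conv_bounded_linear)
    show "0 < 1 / (2 * (norm k + 1))" by (simp add: add_nonneg_pos)
    fix t :: real assume t: "\<bar>t\<bar> < 1 / (2 * (norm k + 1))"
    have "\<bar>t\<bar> * (norm k + 1) < 1 / 2" 
      using t by (simp add: pos_less_divide_eq add_nonneg_pos mult_ac)
    then have tk: "\<bar>t\<bar> * norm k \<le> 1 / 2" by (simp add: algebra_simps)
    have tK: "t *\<^sub>R k \<in> K"
    proof -
      have "t *\<^sub>R k = of_real t *s k" by (simp add: vec_eq_iff scaleR_conv_of_real[where 'a=complex])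
      then show ?thesis using cone k by (simp add: is_complex_cone_def)
    qed
    (* For S + t^2 |k|^2 in place of S the quadratic term in t cancels. *)
    have sq: "(norm (t *\<^sub>R k - y))\<^sup>2 = t\<^sup>2 * (k \<bullet> k) - 2 * t * (k \<bullet> y) + y \<bullet> y" for y
      unfolding power2_norm_eq_inner by (simp add: inner_simps power2_eq_square inner_commute algebra_simps)
    have int: "integral ?Q (\<lambda>y. f y * (exp (- (\<i> / 2 * of_real (om (t *\<^sub>R k) y)))
        * of_real (ramp (Suc N) (S + t\<^sup>2 * (k \<bullet> k) - (norm (t *\<^sub>R k - y))\<^sup>2)))) = 0"
    proof (rule twisted_ramp_integral_zero[OF f om _ means[OF _ tK]])
      fix y assume y: "(norm (t *\<^sub>R k - y))\<^sup>2 < S + t\<^sup>2 * (k \<bullet> k)"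
      have "norm y \<le> R + 1"
      proof (rule ccontr)
        assume "\<not> norm y \<le> R + 1"
        then have ny: "norm y > R + 1" by simp
        have "\<bar>t * (k \<bullet> y)\<bar> \<le> \<bar>t\<bar> * (norm k * norm y)"
          by (simp add: abs_mult mult_left_mono Cauchy_Schwarz_ineq2)
        also have "\<dots> \<le> 1 / 2 * norm y" using mult_right_mono[OF tk norm_ge_zero[of y]] by (simp add: mult.assoc)
        finally have "2 * t * (k \<bullet> y) \<le> norm y" by linarith
        moreover have "y \<bullet> y < S + 2 * t * (k \<bullet> y)" using y by (simp add: sq)
        ultimately have "norm y * norm y - norm y < R\<^sup>2" using S by (simp add: dot_square_norm power2_eq_square)
        moreover have "norm y * norm y - norm y \<ge> R * R"
        proof -
          have "R * R \<le> norm y * (norm y - 1)" using ny R by (intro mult_mono) auto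
          then show ?thesis by (simp add: algebra_simps)
        qed
        ultimately show False by (simp add: power2_eq_square)
      qed
      then show "y \<in> ?Q" using a by (auto simp: dist_norm)
    qed simp_all
    show "integral ?Q (\<lambda>y. f y * (exp (of_real t * A k y) * of_real (ramp (Suc N) (S - y \<bullet> y + t * (2 * (k \<bullet> y)))))) = 0"
    proof -
      have "S + t\<^sup>2 * (k \<bullet> k) - (norm (t *\<^sub>R k - y))\<^sup>2 = S - y \<bullet> y + t * (2 * (k \<bullet> y))" for y
        unfolding sq by simp
      moreover have "- (\<i> / 2 * of_real (om (t *\<^sub>R k) y)) = of_real t * A k y" for y
        by (simp add: A_def om_scale)
      ultimately show ?thesis using int by (simp only:)
    qed
  qed (intro continuous_intros)+
  have y0: "y0 \<in> ?Q" "y0 \<bullet> y0 < R\<^sup>2"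
    using a by (auto simp: R_def dot_square_norm intro!: subsetD[OF a] power_strict_mono)
  (* Any S strictly between |y0|^2 and R^2 makes the weight positive at y0. *)
  define S where "S = (y0 \<bullet> y0 + R\<^sup>2) / 2"
  have S: "S < R\<^sup>2" "y0 \<bullet> y0 < S" using y0 by (simp_all add: S_def)
  have "0 \<in> box (- a) a"
  proof -
    have "ball 0 (R + 1) \<subseteq> interior (cbox (- a) a)"
      using a ball_subset_cball by (intro interior_maximal) (auto intro: order_trans)
    then show ?thesis using R by (auto simp: interior_cbox)
  qed
  then have "box (- a) a \<noteq> {}" by blast
  have "f y0 * of_real (ramp (Suc 0) (S - y0 \<bullet> y0)) = 0"
  proof (rule zero_if_moments_zero[where g="\<lambda>y. f y * of_real (ramp (Suc 0) (S - y \<bullet> y))"])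
    show "integral ?Q (\<lambda>y. f y * of_real (ramp (Suc 0) (S - y \<bullet> y)) * (\<Prod>i<N. of_real (x i \<bullet> y))) = 0" for N :: nat and x
      by (rule ramp_moments_zero[OF cone nh fQ Alin rel S(1)])
  qed (use \<open>box (- a) a \<noteq> {}\<close> y0 in \<open>auto intro!: continuous_intros fQ\<close>)
  moreover have "ramp (Suc 0) (S - y0 \<bullet> y0) \<noteq> 0" using S by (simp add: ramp_def)
  ultimately show "f y0 = 0" by simp
qed

lemma linear_twist:
  fixes M :: "real ^ ('n::finite + 'n) ^ ('n + 'n)"
  shows "linear (\<lambda>w. Re (\<Sum>k\<in>UNIV. z $ k * cnj (complexify (M *v realify w) $ k)))"
proof -
  have "linear (complexify :: real ^ ('n + 'n) \<Rightarrow> complex ^ 'n)"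
    by (rule linearI) (simp_all add: complexify_def vec_eq_iff complex_eq_iff)
  moreover have "linear (realify :: complex ^ 'n \<Rightarrow> real ^ ('n + 'n))"
    by (rule linearI) (simp_all add: realify_def vec_eq_iff split: sum.split)
  ultimately have "linear (\<lambda>w. z \<bullet> complexify (M *v realify w))"
    by (auto intro!: linearI simp: linear_add linear_scale matrix_vector_right_distrib matrix_vector_mult_scaleR inner_simps)
  then show ?thesis unfolding Re_hdot[symmetric] hdot_def .
qed

theorem theorem3p5:
  fixes G :: "((real ^ ('n::{finite,linorder} + 'n)) \<times> (real ^ 'm::finite)) monoid"
    and U :: "'m \<Rightarrow> real ^ ('n + 'n) ^ ('n + 'n)"
    and l :: "real ^ 'm"
    and mu :: "'n \<Rightarrow> real"
    and u v :: "'n \<Rightarrow> real ^ ('n + 'n)"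
    and K :: "(complex ^ 'n::{finite,linorder}) set"
    and f :: "complex ^ 'n::{finite,linorder} \<Rightarrow> complex"
  assumes "metivier_group G U"
    and "l \<noteq> 0"
    and "spectral_data (V_mat U l) mu u v"
    and "CARD('n) \<ge> 2"
    and "is_complex_cone K"
    and "non_harmonic K"
    and "aligned_with_axis (cone_pullback (A_mat u v) K)"
    and "continuous_on UNIV f"
    and "\<And>r z. r > 0 \<Longrightarrow> z \<in> K \<Longrightarrow> twisted_spherical_mean U l f r z = 0"
  shows "f = (\<lambda>_. 0)"
proof -
  define om where "om z w = (\<Sum>j\<in>UNIV. l $ j *
      Re (\<Sum>k\<in>UNIV. z $ k * cnj (complexify (U j *v realify w) $ k)))" for z w
  show ?thesis
  proof (rule zero_if_twisted_means_zero[where om=om])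
    show "linear (om z)" for z
    proof -
      have "linear (\<lambda>w. l $ j * Re (\<Sum>k\<in>UNIV. z $ k * cnj (complexify (U j *v realify w) $ k)))" for j
        using linear_compose_scale_right[OF linear_twist[of z "U j"], of "l $ j"] by simp
      then show ?thesis unfolding om_def[abs_def] by (intro linear_compose_sum) blast
    qed
    show "om (t *\<^sub>R z) w = t * om z w" for t z w
      by (simp add: om_def sum_distrib_left mult_ac right_diff_distrib)
    show "(\<integral>w. f (z - w) * exp (\<i> / 2 * of_real (om z w)) \<partial>sphere_measure s) = 0" if "0 < s" "z \<in> K" for s z
      using assms(9)[OF that] by (simp only: twisted_spherical_mean_def om_def)
  qed (use assms in auto)
qed

end
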